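(* Let $k$ be a field of characteristic $0$, let $R$ be a finite field extension of $k$, let $A=R[\mathcal S,\mathcal D;\sigma,\delta]$ be a differential difference algebra over $R$, and fix a DD-monomial ordering $>$ on the set $\mathcal M$ of standard monomials of $A$. Let $G\subseteq A$ be a set of nonzero elements and let $I$ be the left ideal of $A$ generated by $G$. Then $G$ is a left Gröbner-Shirshov basis for $I$ (with respect to $>$) if and only if $\operatorname{Spoly}(g_1,g_2)\rightarrow_G 0$ for any $g_1,g_2\in G$.
   Context: All algebras are unital associative $k$-algebras; $\mathbb N$ includes $0$. A derivation on an algebra $R$ is a $k$-linear map $\delta$ with $\delta(ab)=a\delta(b)+\delta(a)b$. $R\langle a_1,\dots,a_s\rangle$ denotes the subalgebra generated by $R$ and $a_1,\dots,a_s$. Differential difference algebra: an algebra $A$ is a differential difference algebra of type $(m,n)$ ($m,n\in\mathbb N$) over a subalgebra $R\subseteq A$, written $A=R[\mathcal S,\mathcal D;\sigma,\delta]$, if there are elements $S_1,\dots,S_m,D_1,\dots,D_n\in A$ such that: (i) the elements $S_1^{\alpha_1}\cdots S_m^{\alpha_m}D_1^{\beta_1}\cdots D_n^{\beta_n}$ ($\alpha_i,\beta_j\in\mathbb N$) form a basis of $A$ as a free left $R$-module; (ii) $D_ir=rD_i+\delta_i(r)$ for $r\in R$, $1\le i\le n$, with $\delta_i$ a derivation on $R$; (iii) $S_ir=\sigma_i^{-1}(r)S_i$ (equivalently $rS_i=S_i\sigma_i(r)$) for $r\in R$, $1\le i\le m$, where $\sigma_i$ is a $k$-algebra automorphism of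 $R\langle D_1,\dots,D_n\rangle$ restricting to an automorphism of $R$ and with $\sigma_i(D_j)=\sum_{s=1}^n a_{ijs}D_s$, $a_{ijs}\in R$; (iv) $D_iS_j=S_j\sigma_j(D_i)$; (v) the $S_i$ commute with each other and the $D_j$ commute with each other; (vi) the $\delta_i$ commute with each other and the $\sigma_i$ commute with each other. These elements are fixed. $\mathcal S^\alpha\mathcal D^\beta=S_1^{\alpha_1}\cdots S_m^{\alpha_m}D_1^{\beta_1}\cdots D_n^{\beta_n}$, and $\mathcal M=\{\mathcal S^\alpha\mathcal D^\beta:\alpha\in\mathbb N^m,\beta\in\mathbb N^n\}$. For a total order on $\mathcal M$ and $0\ne f\in A$, $\operatorname{lm}(f)$ is the largest monomial occurring in $f$ with nonzero coefficient (as a left $R$-combination of $\mathcal M$), $\operatorname{lc}(f)$ is its coefficient, $\operatorname{lt}(f)=\operatorname{lc}(f)\operatorname{lm}(f)$. A DD-monomial ordering is a (total) well-ordering $>$ on $\mathcal M$ such that $u>v$ implies $\operatorname{lm}(fu)>\operatorname{lm}(fv)$ for all $0\neq f\in A$. $f$ is right divisible by $g$ if $f=hg$ for some $h\in A$. A set $G\subseteq I$ (of nonzero elements) is a left Gröbner-Shirshov basis of the left ideal $I$ if for every $0\ne f\in I$ there is $g\in G$ with $\operatorname{lm}(f)$ right divisible by $\operatorname{lm}(g)$. Least common left multiple: $\operatorname{lclm}(\mathcal S^\alpha\mathcal D^\beta,\mathcal S^{\alpha'}\mathcal D^{\beta'})=\mathcal S^\mu\mathcal D^\nu$ with $\mu_i=\max\{\alpha_i,\alpha_i'\}$,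 $\nu_j=\max\{\beta_j,\beta_j'\}$; $\operatorname{lclm}(f,g)=\operatorname{lclm}(\operatorname{lm}(f),\operatorname{lm}(g))$. For nonzero $f,g$ there are unique $f',g'\in A$ with $f'\operatorname{lt}(f)=\operatorname{lclm}(f,g)=g'\operatorname{lt}(g)$; then $\operatorname{Spoly}(f,g)=f'f-g'g$. Reduction: $f\rightarrow_g h$ if $h=f-ag$ and $\operatorname{lt}(f)=\operatorname{lt}(ag)$ for some $a\in A$. $f\rightarrow_G h$ if there is a finite chain $f\rightarrow_{g_1}f_1\rightarrow_{g_2}\cdots\rightarrow_{g_t}f_t=h$ with all $g_i\in G$ and $t\in\mathbb N$ ($t=0$ meaning $f=h$). *)

theory Defs
  imports Complex_Main
begin

section \<open>Algebras over a field, subalgebras, derivations\<close>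

locale unital_algebra = vector_space scale
  for scale :: "'k::field \<Rightarrow> 'a::ring_1 \<Rightarrow> 'a" +
  assumes scale_mult_left: "scale c x * y = scale c (x * y)"
    and scale_mult_right: "x * scale c y = scale c (x * y)"

definition subalgebra :: "('k::field \<Rightarrow> 'a::ring_1 \<Rightarrow> 'a) \<Rightarrow> 'a set \<Rightarrow> bool" where
  "subalgebra scale B \<longleftrightarrow>
     module.subspace scale B \<and> 1 \<in> B \<and> (\<forall>a\<in>B. \<forall>b\<in>B. a * b \<in> B)"

definition generated_subalgebra :: "('k::field \<Rightarrow> 'a::ring_1 \<Rightarrow> 'a) \<Rightarrow> 'a set \<Rightarrow> 'a set" where
  "generated_subalgebra scale X = subalgebra scale hull X"

definition derivation_on ::
  "('k::field \<Rightarrow> 'a::ring_1 \<Rightarrow> 'a) \<Rightarrow> 'a set \<Rightarrow> ('a \<Rightarrow> 'a) \<Rightarrow> bool" where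
  "derivation_on scale R d \<longleftrightarrow>
     (\<forall>a\<in>R. d a \<in> R) \<and>
     (\<forall>a\<in>R. \<forall>b\<in>R. d (a + b) = d a + d b) \<and>
     (\<forall>c. \<forall>a\<in>R. d (scale c a) = scale c (d a)) \<and>
     (\<forall>a\<in>R. \<forall>b\<in>R. d (a * b) = a * d b + d a * b)"

definition algebra_automorphism_on ::
  "('k::field \<Rightarrow> 'a::ring_1 \<Rightarrow> 'a) \<Rightarrow> 'a set \<Rightarrow> ('a \<Rightarrow> 'a) \<Rightarrow> bool" where
  "algebra_automorphism_on scale B h \<longleftrightarrow>
     bij_betw h B B \<and> h 1 = 1 \<and>
     (\<forall>a\<in>B. \<forall>b\<in>B. h (a + b) = h a + h b) \<and>
     (\<forall>c. \<forall>a\<in>B. h (scale c a) = scale c (h a)) \<and>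
     (\<forall>a\<in>B. \<forall>b\<in>B. h (a * b) = h a * h b)"

text \<open>The base field \<open>k\<close> sits inside \<open>R\<close> as the set of all \<open>scale c 1\<close>.\<close>

definition finite_field_extension :: "('k::field \<Rightarrow> 'a::ring_1 \<Rightarrow> 'a) \<Rightarrow> 'a set \<Rightarrow> bool" where
  "finite_field_extension scale R \<longleftrightarrow>
     subalgebra scale R \<and>
     (\<forall>a\<in>R. \<forall>b\<in>R. a * b = b * a) \<and>
     (\<forall>a\<in>R. a \<noteq> 0 \<longrightarrow> (\<exists>b\<in>R. a * b = 1)) \<and>
     (\<exists>B. finite B \<and> module.span scale B = R)"

section \<open>Standard monomials and left coefficients\<close>

text \<open>Elements of \<open>\<nat>\<^sup>m\<close> are functions vanishing outside \<open>{1..m}\<close>, so that distinct functions are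
  distinct exponents.\<close>

definition exponents :: "nat \<Rightarrow> (nat \<Rightarrow> nat) set" where
  "exponents m = {\<alpha>. \<forall>i. \<alpha> i \<noteq> 0 \<longrightarrow> i \<in> {1..m}}"

definition power_product :: "nat \<Rightarrow> (nat \<Rightarrow> 'a::monoid_mult) \<Rightarrow> (nat \<Rightarrow> nat) \<Rightarrow> 'a" where
  "power_product m X \<alpha> = prod_list (map (\<lambda>i. X i ^ \<alpha> i) [1..<Suc m])"

definition std_monomial ::
  "nat \<Rightarrow> nat \<Rightarrow> (nat \<Rightarrow> 'a::monoid_mult) \<Rightarrow> (nat \<Rightarrow> 'a) \<Rightarrow> (nat \<Rightarrow> nat) \<times> (nat \<Rightarrow> nat) \<Rightarrow> 'a" where
  "std_monomial m n S D = (\<lambda>(\<alpha>, \<beta>). power_product m S \<alpha> * power_product n D \<beta>)"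

definition std_monomials ::
  "nat \<Rightarrow> nat \<Rightarrow> (nat \<Rightarrow> 'a::monoid_mult) \<Rightarrow> (nat \<Rightarrow> 'a) \<Rightarrow> 'a set" where
  "std_monomials m n S D = std_monomial m n S D ` (exponents m \<times> exponents n)"

definition left_expansion :: "'a::ring_1 set \<Rightarrow> 'a set \<Rightarrow> 'a \<Rightarrow> ('a \<Rightarrow> 'a) \<Rightarrow> bool" where
  "left_expansion R M f c \<longleftrightarrow>
     finite {u. c u \<noteq> 0} \<and> {u. c u \<noteq> 0} \<subseteq> M \<and> range c \<subseteq> R \<and>
     f = (\<Sum>u | c u \<noteq> 0. c u * u)"

definition left_module_basis :: "'a::ring_1 set \<Rightarrow> 'a set \<Rightarrow> bool" where
  "left_module_basis R M \<longleftrightarrow> (\<forall>f. \<exists>!c. left_expansion R M f c)"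

definition left_coeff :: "'a::ring_1 set \<Rightarrow> 'a set \<Rightarrow> 'a \<Rightarrow> 'a \<Rightarrow> 'a" where
  "left_coeff R M f = (THE c. left_expansion R M f c)"

section \<open>Differential difference algebras\<close>

locale dd_algebra = unital_algebra scale
  for scale :: "'k::field \<Rightarrow> 'a::ring_1 \<Rightarrow> 'a" +
  fixes R :: "'a set"
    and m n :: nat
    and S D :: "nat \<Rightarrow> 'a"
    and \<sigma> \<delta> :: "nat \<Rightarrow> 'a \<Rightarrow> 'a"
  assumes subalgebra_R: "subalgebra scale R"
    and inj_std_monomial: "inj_on (std_monomial m n S D) (exponents m \<times> exponents n)"
    and basis: "left_module_basis R (std_monomials m n S D)"
    and derivation: "\<And>i. i \<in> {1..n} \<Longrightarrow> derivation_on scale R (\<delta> i)"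
    and D_mult: "\<And>i r. \<lbrakk>i \<in> {1..n}; r \<in> R\<rbrakk> \<Longrightarrow> D i * r = r * D i + \<delta> i r"
    and automorphism: "\<And>i. i \<in> {1..m} \<Longrightarrow>
      algebra_automorphism_on scale (generated_subalgebra scale (R \<union> D ` {1..n})) (\<sigma> i)"
    and automorphism_R: "\<And>i. i \<in> {1..m} \<Longrightarrow> algebra_automorphism_on scale R (\<sigma> i)"
    and \<sigma>_D: "\<exists>a. \<forall>i\<in>{1..m}. \<forall>j\<in>{1..n}.
      (\<forall>s\<in>{1..n}. a i j s \<in> R) \<and> \<sigma> i (D j) = (\<Sum>s=1..n. a i j s * D s)"
    and S_mult: "\<And>i r. \<lbrakk>i \<in> {1..m}; r \<in> R\<rbrakk> \<Longrightarrow> S i * r = the_inv_into R (\<sigma> i) r * S i"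
    and D_S: "\<And>i j. \<lbrakk>i \<in> {1..n}; j \<in> {1..m}\<rbrakk> \<Longrightarrow> D i * S j = S j * \<sigma> j (D i)"
    and S_commute: "\<And>i j. \<lbrakk>i \<in> {1..m}; j \<in> {1..m}\<rbrakk> \<Longrightarrow> S i * S j = S j * S i"
    and D_commute: "\<And>i j. \<lbrakk>i \<in> {1..n}; j \<in> {1..n}\<rbrakk> \<Longrightarrow> D i * D j = D j * D i"
    and \<delta>_commute: "\<And>i j r. \<lbrakk>i \<in> {1..n}; j \<in> {1..n}; r \<in> R\<rbrakk> \<Longrightarrow> \<delta> i (\<delta> j r) = \<delta> j (\<delta> i r)"
    and \<sigma>_commute: "\<And>i j x. \<lbrakk>i \<in> {1..m}; j \<in> {1..m};
      x \<in> generated_subalgebra scale (R \<union> D ` {1..n})\<rbrakk> \<Longrightarrow> \<sigma> i (\<sigma> j x) = \<sigma> j (\<sigma> i x)"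

section \<open>Monomial orderings and leading terms\<close>

text \<open>Below, \<open>M\<close> is the set of standard monomials and the order \<open>\<le>\<close> on it is a relation
  \<open>ord\<close>, with \<open>(v, u) \<in> ord\<close> meaning \<open>v \<le> u\<close>. The constants \<open>lm\<close>, \<open>lc\<close>, \<open>lt\<close> are meaningful only
  at nonzero arguments.\<close>

definition lm :: "'a::ring_1 set \<Rightarrow> 'a set \<Rightarrow> 'a rel \<Rightarrow> 'a \<Rightarrow> 'a" where
  "lm R M ord f =
     (THE u. left_coeff R M f u \<noteq> 0 \<and> (\<forall>v. left_coeff R M f v \<noteq> 0 \<longrightarrow> (v, u) \<in> ord))"

definition lc :: "'a::ring_1 set \<Rightarrow> 'a set \<Rightarrow> 'a rel \<Rightarrow> 'a \<Rightarrow> 'a" where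
  "lc R M ord f = left_coeff R M f (lm R M ord f)"

definition lt :: "'a::ring_1 set \<Rightarrow> 'a set \<Rightarrow> 'a rel \<Rightarrow> 'a \<Rightarrow> 'a" where
  "lt R M ord f = lc R M ord f * lm R M ord f"

definition dd_monomial_ordering :: "'a::ring_1 set \<Rightarrow> 'a set \<Rightarrow> 'a rel \<Rightarrow> bool" where
  "dd_monomial_ordering R M ord \<longleftrightarrow>
     well_order_on M ord \<and>
     (\<forall>u\<in>M. \<forall>v\<in>M. \<forall>f. (v, u) \<in> ord - Id \<and> f \<noteq> 0 \<longrightarrow>
        (lm R M ord (f * v), lm R M ord (f * u)) \<in> ord - Id)"

section \<open>Left ideals and Groebner-Shirshov bases\<close>

definition left_ideal :: "'a::ring_1 set \<Rightarrow> bool" where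
  "left_ideal J \<longleftrightarrow>
     0 \<in> J \<and> (\<forall>x\<in>J. \<forall>y\<in>J. x + y \<in> J) \<and> (\<forall>a. \<forall>x\<in>J. a * x \<in> J)"

definition right_divisible :: "'a::times \<Rightarrow> 'a \<Rightarrow> bool" where
  "right_divisible f g \<longleftrightarrow> (\<exists>h. f = h * g)"

definition left_GS_basis :: "'a::ring_1 set \<Rightarrow> 'a set \<Rightarrow> 'a rel \<Rightarrow> 'a set \<Rightarrow> 'a set \<Rightarrow> bool" where
  "left_GS_basis R M ord G I \<longleftrightarrow>
     G \<subseteq> I \<and> 0 \<notin> G \<and>
     (\<forall>f\<in>I. f \<noteq> 0 \<longrightarrow> (\<exists>g\<in>G. right_divisible (lm R M ord f) (lm R M ord g)))"

section \<open>S-polynomials and reduction\<close>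

definition lclm_monomial ::
  "nat \<Rightarrow> nat \<Rightarrow> (nat \<Rightarrow> 'a::ring_1) \<Rightarrow> (nat \<Rightarrow> 'a) \<Rightarrow> 'a \<Rightarrow> 'a \<Rightarrow> 'a" where
  "lclm_monomial m n S D u v =
     (let expo = the_inv_into (exponents m \<times> exponents n) (std_monomial m n S D);
          (\<alpha>, \<beta>) = expo u; (\<alpha>', \<beta>') = expo v
      in std_monomial m n S D (\<lambda>i. max (\<alpha> i) (\<alpha>' i), \<lambda>j. max (\<beta> j) (\<beta>' j)))"

definition lclm ::
  "'a::ring_1 set \<Rightarrow> nat \<Rightarrow> nat \<Rightarrow> (nat \<Rightarrow> 'a) \<Rightarrow> (nat \<Rightarrow> 'a) \<Rightarrow> 'a rel \<Rightarrow> 'a \<Rightarrow> 'a \<Rightarrow> 'a" where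
  "lclm R m n S D ord f g =
     (let M = std_monomials m n S D
      in lclm_monomial m n S D (lm R M ord f) (lm R M ord g))"

definition Spoly ::
  "'a::ring_1 set \<Rightarrow> nat \<Rightarrow> nat \<Rightarrow> (nat \<Rightarrow> 'a) \<Rightarrow> (nat \<Rightarrow> 'a) \<Rightarrow> 'a rel \<Rightarrow> 'a \<Rightarrow> 'a \<Rightarrow> 'a" where
  "Spoly R m n S D ord f g =
     (let M = std_monomials m n S D; w = lclm R m n S D ord f g
      in (THE f'. f' * lt R M ord f = w) * f - (THE g'. g' * lt R M ord g = w) * g)"

text \<open>\<open>lt f = lt (a * g)\<close> presupposes that both arguments are nonzero.\<close>

definition reduction_step :: "'a::ring_1 set \<Rightarrow> 'a set \<Rightarrow> 'a rel \<Rightarrow> 'a \<Rightarrow> 'a \<Rightarrow> 'a \<Rightarrow> bool" where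
  "reduction_step R M ord g f h \<longleftrightarrow>
     (\<exists>a. f \<noteq> 0 \<and> a * g \<noteq> 0 \<and> lt R M ord f = lt R M ord (a * g) \<and> h = f - a * g)"

definition reduces_to :: "'a::ring_1 set \<Rightarrow> 'a set \<Rightarrow> 'a rel \<Rightarrow> 'a set \<Rightarrow> 'a \<Rightarrow> 'a \<Rightarrow> bool" where
  "reduces_to R M ord G = (\<lambda>f h. \<exists>g\<in>G. reduction_step R M ord g f h)\<^sup>*\<^sup>*"

end

theory Submission
  imports Defs
begin

text \<open>
  The proof rests on one structural fact. Since \<open>R\<close> is finite over a field of characteristic zero,
  every derivation of \<open>R\<close> vanishes (\<open>derivation_eq_zero\<close>), so the \<open>D\<^sub>i\<close> commute with \<open>R\<close> and
  \<open>B = R\<langle>D\<^sub>1,\<dots>,D\<^sub>n\<rangle>\<close> is commutative. The relations \<open>x S\<^sub>j = S\<^sub>j \<sigma>\<^sub>j(x)\<close> extend from generators to all of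
  \<open>B\<close>, and as \<open>\<sigma>\<^sub>j\<close> is bijective, \<open>B S\<^sup>\<alpha> = S\<^sup>\<alpha> B\<close>. Consequently a standard monomial \<open>u\<close> divides a standard
  monomial \<open>w\<close> on the right exactly when its exponents are bounded by those of \<open>w\<close>
  (\<open>right_divisible_iff\<close>), and then a quotient can be written \<open>h = S\<^sup>\<gamma> y\<close> with \<open>y \<in> B\<close>. Such an \<open>h\<close>
  normalizes \<open>R\<close>, that is \<open>h R \<subseteq> R h\<close>.

  Normalization is what makes division compatible with the ordering. The ordering compares
  \<open>lm(h v)\<close> and \<open>lm(h u)\<close> for monomials \<open>v < u\<close> only; in a product \<open>h (\<Sum> c\<^sub>v v)\<close> the coefficients stand
  between \<open>h\<close> and \<open>v\<close>, and for general \<open>h\<close> the element \<open>h c\<^sub>v\<close> need not be a left \<open>R\<close>-multiple of \<open>h\<close>. For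
  normalizing \<open>h\<close> they move to the left, so that \<open>h lt(g) = w\<close> implies that \<open>h g - w\<close>
  involves only monomials below \<open>w\<close> (\<open>quotient_mult_minus_monomial\<close>).
  An arbitrary multiplier \<open>a\<close> is handled by expanding
  \<open>a lt(g)\<close> into monomials \<open>w\<close>, each right divisible by \<open>lm(g)\<close>: cancelling \<open>lt(g)\<close> writes \<open>a\<close> as a
  left \<open>R\<close>-combination of normalizing quotients, whence \<open>lm(g)\<close> divides \<open>lm(a g)\<close>
  (\<open>lead_monom_left_multiple\<close>).

  Buchberger's argument then applies. For a monomial \<open>w\<close> divisible by \<open>lm(f)\<close> and \<open>lm(g)\<close>, the
  difference \<open>x f - y g\<close> of the two multiples with leading term \<open>w\<close> is \<open>q Spoly(f, g)\<close> with
  \<open>q lclm(f, g) = w\<close>. If the S-polynomials reduce to zero, this difference is a sum of multiples of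
  members of \<open>G\<close> supported strictly below \<open>w\<close> (\<open>quotient_difference_combinations\<close>). Hence, in an
  element of the ideal written as a sum of multiples supported up to \<open>w\<close>, all contributions at \<open>w\<close> can
  be shifted to a single \<open>g\<close> (\<open>combinations_top\<close>): either they add up to a nonzero coefficient, and
  the leading monomial \<open>w\<close> is divisible by \<open>lm(g)\<close>, or \<open>w\<close> can be lowered, and well-foundedness
  finishes (\<open>lead_monom_divisible_if_s_polys_reduce\<close>). Conversely, if the leading monomials of \<open>G\<close>
  divide those of the ideal, any element of the ideal, in particular an S-polynomial, reduces to zero
  by repeatedly removing its leading term (\<open>reduces_to_zero_if_GS_basis\<close>).
\<close>

section \<open>Coefficients with respect to a left basis over a field\<close>

definition normalizes :: "'a::ring_1 set \<Rightarrow> 'a \<Rightarrow> bool" where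
  "normalizes R h \<longleftrightarrow> (\<forall>r\<in>R. \<exists>r'\<in>R. h * r = r' * h)"

lemma normalizes_one: "normalizes R 1"
  by (auto simp: normalizes_def)

lemma normalizes_mult: "normalizes R x \<Longrightarrow> normalizes R y \<Longrightarrow> normalizes R (x * y)"
proof -
  assume x: "normalizes R x" and y: "normalizes R y"
  show ?thesis
    unfolding normalizes_def
  proof
    fix r assume "r \<in> R"
    then obtain r' where r': "r' \<in> R" "y * r = r' * y" using y unfolding normalizes_def by blast
    then obtain r'' where r'': "r'' \<in> R" "x * r' = r'' * x" using x unfolding normalizes_def by blast
    have "x * y * r = x * r' * y" using r'(2) by (simp add: mult.assoc)
    then show "\<exists>r'\<in>R. x * y * r = r' * (x * y)" using r'' by (auto simp: mult.assoc)
  qed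
qed

locale left_basis =
  fixes R M :: "'a::ring_1 set"
  assumes one_R: "1 \<in> R"
    and add_R: "\<And>a b. a \<in> R \<Longrightarrow> b \<in> R \<Longrightarrow> a + b \<in> R"
    and uminus_R: "\<And>a. a \<in> R \<Longrightarrow> - a \<in> R"
    and mult_R: "\<And>a b. a \<in> R \<Longrightarrow> b \<in> R \<Longrightarrow> a * b \<in> R"
    and commute_R: "\<And>a b. a \<in> R \<Longrightarrow> b \<in> R \<Longrightarrow> a * b = b * a"
    and inverse_R: "\<And>a. a \<in> R \<Longrightarrow> a \<noteq> 0 \<Longrightarrow> \<exists>b\<in>R. a * b = 1"
    and basis_M: "left_module_basis R M"
begin

abbreviation coeff :: "'a \<Rightarrow> 'a \<Rightarrow> 'a" where "coeff \<equiv> left_coeff R M"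

lemma zero_R: "0 \<in> R"
  using add_R[OF one_R uminus_R[OF one_R]] by simp

lemma expansion_coeff: "left_expansion R M f (coeff f)"
  using basis_M unfolding left_module_basis_def left_coeff_def by (metis theI')

lemma coeff_eqI: "left_expansion R M f c \<Longrightarrow> coeff f = c"
  using basis_M expansion_coeff unfolding left_module_basis_def by blast

lemma coeff_in_R: "coeff f u \<in> R"
  and coeff_in_M: "coeff f u \<noteq> 0 \<Longrightarrow> u \<in> M"
  and finite_coeff: "finite {u. coeff f u \<noteq> 0}"
  and expansion: "f = (\<Sum>u | coeff f u \<noteq> 0. coeff f u * u)"
  using expansion_coeff[of f] unfolding left_expansion_def by auto

lemma coeff_eq_sumI:
  assumes "finite F" "F \<subseteq> M" "\<And>u. c u \<noteq> 0 \<Longrightarrow> u \<in> F" "\<And>u. c u \<in> R" "f = (\<Sum>u\<in>F. c u * u)"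
  shows "coeff f = c"
proof (rule coeff_eqI)
  have "(\<Sum>u\<in>F. c u * u) = (\<Sum>u | c u \<noteq> 0. c u * u)"
    using assms(1,3) by (intro sum.mono_neutral_right) auto
  moreover have "finite {u. c u \<noteq> 0}" "{u. c u \<noteq> 0} \<subseteq> F"
    using finite_subset[of "{u. c u \<noteq> 0}" F] assms(1,3) by auto
  ultimately show "left_expansion R M f c"
    unfolding left_expansion_def using assms by auto
qed

lemma coeff_add: "coeff (f + g) u = coeff f u + coeff g u"
proof -
  let ?F = "{u. coeff f u \<noteq> 0} \<union> {u. coeff g u \<noteq> 0}"
  have "f = (\<Sum>u\<in>?F. coeff f u * u)" "g = (\<Sum>u\<in>?F. coeff g u * u)"
    by (subst expansion, rule sum.mono_neutral_left, auto simp: finite_coeff)+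
  then have "f + g = (\<Sum>u\<in>?F. (coeff f u + coeff g u) * u)"
    by (simp add: distrib_right sum.distrib)
  then have "coeff (f + g) = (\<lambda>u. coeff f u + coeff g u)"
    by (intro coeff_eq_sumI[where F = ?F]) (auto simp: finite_coeff coeff_in_R add_R dest: coeff_in_M)
  then show ?thesis by simp
qed

lemma coeff_mult_left: "r \<in> R \<Longrightarrow> coeff (r * f) u = r * coeff f u"
proof -
  assume r: "r \<in> R"
  let ?F = "{u. coeff f u \<noteq> 0}"
  have "r * f = (\<Sum>u\<in>?F. r * coeff f u * u)"
    by (subst (1) expansion[of f]) (simp add: sum_distrib_left mult.assoc)
  then have "coeff (r * f) = (\<lambda>u. r * coeff f u)"
    using r by (intro coeff_eq_sumI[where F = ?F])
      (auto simp: finite_coeff coeff_in_R mult_R dest: coeff_in_M)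
  then show ?thesis by simp
qed

lemma coeff_monomial: "u \<in> M \<Longrightarrow> coeff u = (\<lambda>v. if v = u then 1 else 0)"
  by (rule coeff_eq_sumI[where F = "{u}"]) (auto simp: one_R zero_R split: if_splits)

lemma coeff_zero: "coeff 0 u = 0"
  using coeff_mult_left[OF zero_R, of 0 u] by simp

lemma coeff_diff: "coeff (f - g) u = coeff f u - coeff g u"
  using coeff_add[of "f - g" g u] by (simp add: algebra_simps)

lemma eq_zero_if_no_coeff: "(\<And>u. coeff f u = 0) \<Longrightarrow> f = 0"
  using expansion[of f] by simp

lemma monomial_nonzero: "u \<in> M \<Longrightarrow> u \<noteq> 0"
  using coeff_monomial[of u] coeff_zero[of u] by (auto simp: fun_eq_iff)

definition supported :: "'a set \<Rightarrow> 'a set" where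
  "supported P = {f. \<forall>u. coeff f u \<noteq> 0 \<longrightarrow> u \<in> P}"

lemma supported_zero: "0 \<in> supported P"
  by (simp add: supported_def coeff_zero)

lemma supported_add: "f \<in> supported P \<Longrightarrow> g \<in> supported P \<Longrightarrow> f + g \<in> supported P"
  unfolding supported_def by (auto simp: coeff_add) (metis add.right_neutral)

lemma supported_mult: "r \<in> R \<Longrightarrow> f \<in> supported P \<Longrightarrow> r * f \<in> supported P"
  unfolding supported_def by (auto simp: coeff_mult_left) (metis mult_zero_right)

lemma supported_diff: "f \<in> supported P \<Longrightarrow> g \<in> supported P \<Longrightarrow> f - g \<in> supported P"
  using supported_add[OF _ supported_mult[OF uminus_R[OF one_R]], of f P g] by simp

lemma supported_monomial: "u \<in> M \<Longrightarrow> u \<in> P \<Longrightarrow> u \<in> supported P"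
  by (simp add: supported_def coeff_monomial)

lemma supported_mono: "f \<in> supported P \<Longrightarrow> P \<subseteq> Q \<Longrightarrow> f \<in> supported Q"
  unfolding supported_def by blast

lemma supported_M: "f \<in> supported M"
  unfolding supported_def using coeff_in_M by blast

lemma supported_sum: "(\<And>i. i \<in> F \<Longrightarrow> f i \<in> supported P) \<Longrightarrow> (\<Sum>i\<in>F. f i) \<in> supported P"
  by (induction F rule: infinite_finite_induct) (auto simp: supported_zero supported_add)

lemma coeff_outside: "f \<in> supported P \<Longrightarrow> u \<notin> P \<Longrightarrow> coeff f u = 0"
  unfolding supported_def by auto

text \<open>
  The coefficients stay inside the premise because \<open>h\<close> need not commute with them.
\<close>

lemma supported_mult_expansion:
  assumes "\<And>u. coeff f u \<noteq> 0 \<Longrightarrow> h * (coeff f u * u) \<in> supported P"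
  shows "h * f \<in> supported P"
proof -
  have "h * f = (\<Sum>u | coeff f u \<noteq> 0. h * (coeff f u * u))"
    by (subst (1) expansion[of f]) (simp add: sum_distrib_left)
  then show ?thesis using assms by (auto intro!: supported_sum)
qed

end

section \<open>Leading monomials\<close>

locale ordered_left_basis = left_basis R M
  for R M :: "'a::ring_1 set" +
  fixes ord :: "'a rel"
  assumes dd_ordering: "dd_monomial_ordering R M ord"
begin

abbreviation lead_monom :: "'a \<Rightarrow> 'a" where "lead_monom \<equiv> lm R M ord"
abbreviation lead_coeff :: "'a \<Rightarrow> 'a" where "lead_coeff \<equiv> lc R M ord"
abbreviation lead_term :: "'a \<Rightarrow> 'a" where "lead_term \<equiv> lt R M ord"

lemma ord_well: "well_order_on M ord"
  using dd_ordering unfolding dd_monomial_ordering_def by blast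

lemma ord_wf: "wf (ord - Id)"
  using ord_well unfolding well_order_on_def by blast

lemma ord_refl: "u \<in> M \<Longrightarrow> (u, u) \<in> ord"
  using ord_well unfolding order_on_defs refl_on_def by blast

lemma ord_total: "u \<in> M \<Longrightarrow> v \<in> M \<Longrightarrow> (u, v) \<in> ord \<or> (v, u) \<in> ord"
  using ord_well ord_refl unfolding order_on_defs total_on_def by (cases "u = v") auto

lemma ord_trans: "(u, v) \<in> ord \<Longrightarrow> (v, w) \<in> ord \<Longrightarrow> (u, w) \<in> ord"
  using ord_well unfolding order_on_defs trans_def by blast

lemma ord_antisym: "(u, v) \<in> ord \<Longrightarrow> (v, u) \<in> ord \<Longrightarrow> u = v"
  using ord_well unfolding order_on_defs antisym_def by blast

lemma ord_in_M: "(u, v) \<in> ord \<Longrightarrow> u \<in> M \<and> v \<in> M"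
  using ord_well unfolding order_on_defs by auto

lemma ord_mult:
  assumes "v \<in> underS ord u" "f \<noteq> 0"
  shows "lead_monom (f * v) \<in> underS ord (lead_monom (f * u))"
proof -
  have "(v, u) \<in> ord - Id" "u \<in> M" "v \<in> M" using assms(1) ord_in_M by (auto simp: underS_def)
  then show ?thesis
    using dd_ordering assms(2) unfolding dd_monomial_ordering_def underS_def by blast
qed

lemma under_subset_underS: "v \<in> underS ord w \<Longrightarrow> under ord v \<subseteq> underS ord w"
  and under_mono: "(v, w) \<in> ord \<Longrightarrow> under ord v \<subseteq> under ord w"
  and underS_subset_under: "underS ord w \<subseteq> under ord w"
  and underS_subset_M: "underS ord w \<subseteq> M"
  and not_in_underS: "w \<notin> underS ord w"
  and underS_split: "u \<in> under ord w \<Longrightarrow> u \<noteq> w \<Longrightarrow> u \<in> underS ord w"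
  and in_under: "w \<in> M \<Longrightarrow> w \<in> under ord w"
  unfolding under_def underS_def
  using ord_trans ord_antisym ord_in_M ord_refl by blast+

lemma underS_mono: "(v, w) \<in> ord \<Longrightarrow> underS ord v \<subseteq> underS ord w"
  unfolding underS_def using ord_trans ord_antisym by blast

lemma finite_has_greatest:
  assumes "finite F" "F \<noteq> {}" "F \<subseteq> M"
  shows "\<exists>u\<in>F. F \<subseteq> under ord u"
  using assms
proof (induction F rule: finite_ne_induct)
  case (singleton x) then show ?case by (auto simp: under_def ord_refl)
next
  case (insert x F)
  then obtain u where u: "u \<in> F" "F \<subseteq> under ord u" by auto
  then consider "(x, u) \<in> ord" | "(u, x) \<in> ord" using ord_total insert.prems by blast
  then show ?case
  proof cases
    case 1 then show ?thesis using u by (auto simp: under_def)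
  next
    case 2
    then have "insert x F \<subseteq> under ord x"
      using u under_mono[OF 2] insert.prems by (auto simp: in_under)
    then show ?thesis by blast
  qed
qed

lemma lead_monom_eqI:
  assumes "coeff f u \<noteq> 0" "f \<in> supported (under ord u)"
  shows "lead_monom f = u"
  unfolding lm_def using assms ord_antisym
  by (intro the_equality) (auto simp: supported_def under_def)

lemma
  assumes "f \<noteq> 0"
  shows lead_coeff_nonzero: "lead_coeff f \<noteq> 0"
    and lead_monom_in_M: "lead_monom f \<in> M"
    and supported_under_lead: "f \<in> supported (under ord (lead_monom f))"
proof -
  have "{u. coeff f u \<noteq> 0} \<noteq> {}" using assms eq_zero_if_no_coeff by blast
  then obtain u where u: "coeff f u \<noteq> 0" "f \<in> supported (under ord u)"
    using finite_has_greatest[OF finite_coeff[of f]] coeff_in_M[of f] unfolding supported_def by blast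
  then have "lead_monom f = u" by (rule lead_monom_eqI)
  then show "lead_coeff f \<noteq> 0" "lead_monom f \<in> M" "f \<in> supported (under ord (lead_monom f))"
    using u coeff_in_M by (auto simp: lc_def)
qed

lemma lead_coeff_in_R: "lead_coeff f \<in> R"
  by (simp add: lc_def coeff_in_R)

lemma lead_monom_mem:
  assumes "f \<noteq> 0" "f \<in> supported P" shows "lead_monom f \<in> P"
  using lead_coeff_nonzero[OF assms(1)] assms(2) by (auto simp: supported_def lc_def)

lemma lead_monom_scaled_monomial:
  assumes "c \<in> R" "c \<noteq> 0" "w \<in> M"
  shows "lead_monom (c * w) = w"
  using assms
  by (intro lead_monom_eqI supported_mult supported_monomial)
    (auto simp: coeff_mult_left coeff_monomial in_under)

lemma supported_minus_top:
  assumes "f \<in> supported (under ord w)" "h \<in> supported (under ord w)" "coeff f w = coeff h w"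
  shows "f - h \<in> supported (underS ord w)"
  using supported_diff[OF assms(1,2)] assms(3) underS_split
  by (fastforce simp: supported_def coeff_diff)

lemma minus_lead_term:
  assumes "f \<noteq> 0"
  shows "f - lead_term f \<in> supported (underS ord (lead_monom f))"
  unfolding lt_def
  using assms lead_monom_in_M lead_coeff_in_R
  by (intro supported_minus_top supported_under_lead supported_mult supported_monomial)
    (auto simp: in_under coeff_mult_left coeff_monomial lc_def)

lemma lead_monom_eq_if_lead_term_eq:
  assumes "f \<noteq> 0" "h \<noteq> 0" "lead_term f = lead_term h"
  shows "lead_monom f = lead_monom h"
  using assms lead_monom_scaled_monomial lead_coeff_in_R lead_coeff_nonzero lead_monom_in_M
  unfolding lt_def by metis

text \<open>
  The only point where the compatibility of the ordering with multiplication enters the estimates: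
  coefficients of \<open>f\<close> are moved to the left of \<open>h\<close>, and what remains are the products \<open>h * v\<close> that the
  ordering compares.
\<close>

lemma normalizes_mult_supported:
  assumes "normalizes R h" "h \<noteq> 0" "f \<in> supported (underS ord u)"
  shows "h * f \<in> supported (underS ord (lead_monom (h * u)))"
proof (rule supported_mult_expansion)
  fix v assume "coeff f v \<noteq> 0"
  then have "v \<in> underS ord u" using assms(3) by (auto simp: supported_def)
  then have less: "lead_monom (h * v) \<in> underS ord (lead_monom (h * u))"
    using ord_mult assms(2) by blast
  obtain r where r: "r \<in> R" "h * coeff f v = r * h"
    using assms(1) coeff_in_R unfolding normalizes_def by blast
  have "h * v \<in> supported (underS ord (lead_monom (h * u)))"
  proof (cases "h * v = 0")
    case False
    then show ?thesis
      using supported_mono[OF supported_under_lead under_subset_underS[OF less]] by blast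
  qed (simp add: supported_zero)
  then have "r * (h * v) \<in> supported (underS ord (lead_monom (h * u)))"
    using r(1) supported_mult by blast
  then show "h * (coeff f v * v) \<in> supported (underS ord (lead_monom (h * u)))"
    using r(2) by (simp flip: mult.assoc)
qed

end

section \<open>Buchberger's criterion in the presence of normalizing multipliers\<close>

text \<open>
  The facts about monomials that the criterion uses. In a differential difference algebra, right
  divisibility of monomials is comparison of exponents, and \<open>lcl\<close> is the componentwise maximum. The
  essential assumption is \<open>ex_normalizing_quotient\<close>: quotients of monomials can be chosen to normalize
  \<open>R\<close>.
\<close>

locale monomial_division = ordered_left_basis R M ord
  for R M :: "'a::ring_1 set" and ord :: "'a rel" +
  fixes lcl :: "'a \<Rightarrow> 'a \<Rightarrow> 'a"
  assumes cancel_monomial: "\<And>u x. u \<in> M \<Longrightarrow> x * u = 0 \<Longrightarrow> x = 0"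
    and mult_monomial_supported:
      "\<And>u x. u \<in> M \<Longrightarrow> x * u \<in> supported {w \<in> M. right_divisible w u}"
    and ex_normalizing_quotient:
      "\<And>u w. u \<in> M \<Longrightarrow> w \<in> M \<Longrightarrow> right_divisible w u \<Longrightarrow> \<exists>h. normalizes R h \<and> h * u = w"
    and lcl_in_M: "\<And>u v. u \<in> M \<Longrightarrow> v \<in> M \<Longrightarrow> lcl u v \<in> M"
    and lcl_left: "\<And>u v. u \<in> M \<Longrightarrow> v \<in> M \<Longrightarrow> right_divisible (lcl u v) u"
    and lcl_right: "\<And>u v. u \<in> M \<Longrightarrow> v \<in> M \<Longrightarrow> right_divisible (lcl u v) v"
    and lcl_least: "\<And>u v w. u \<in> M \<Longrightarrow> v \<in> M \<Longrightarrow> w \<in> M \<Longrightarrow> right_divisible w u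
      \<Longrightarrow> right_divisible w v \<Longrightarrow> right_divisible w (lcl u v)"
begin

definition s_poly :: "'a \<Rightarrow> 'a \<Rightarrow> 'a" where
  "s_poly f g = (let w = lcl (lead_monom f) (lead_monom g)
     in (THE f'. f' * lead_term f = w) * f - (THE g'. g' * lead_term g = w) * g)"

lemma cancel_lead_term:
  assumes "g \<noteq> 0" "x * lead_term g = y * lead_term g"
  shows "x = y"
proof -
  have "((x - y) * lead_coeff g) * lead_monom g = 0"
    using assms(2) by (simp add: lt_def algebra_simps)
  then have "(x - y) * lead_coeff g = 0" using cancel_monomial lead_monom_in_M assms(1) by blast
  moreover obtain b where "lead_coeff g * b = 1"
    using inverse_R lead_coeff_in_R lead_coeff_nonzero assms(1) by blast
  ultimately have "x - y = 0" by (metis mult.assoc mult_1_right mult_zero_left)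
  then show ?thesis by simp
qed

lemma ex_quotient_lead_term:
  assumes g: "g \<noteq> 0" and w: "w \<in> M" "right_divisible w (lead_monom g)"
  shows "\<exists>h. normalizes R h \<and> h * lead_term g = w"
proof -
  obtain h where h: "normalizes R h" "h * lead_monom g = w"
    using ex_normalizing_quotient lead_monom_in_M g w by blast
  obtain b where b: "b \<in> R" "lead_coeff g * b = 1"
    using inverse_R lead_coeff_in_R lead_coeff_nonzero g by blast
  have "b * lead_coeff g = 1" using b commute_R lead_coeff_in_R by metis
  then have "h * b * lead_term g = w"
    using h(2) unfolding lt_def by (metis mult.assoc mult_1_left)
  moreover have "normalizes R (h * b)"
    unfolding normalizes_def
  proof
    fix r assume r: "r \<in> R"
    then obtain r' where "r' \<in> R" "h * r = r' * h" using h(1) unfolding normalizes_def by blast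
    moreover have "h * b * r = h * r * b" using commute_R[OF b(1) r] by (simp add: mult.assoc)
    ultimately show "\<exists>r'\<in>R. h * b * r = r' * (h * b)" by (metis mult.assoc)
  qed
  ultimately show ?thesis by blast
qed

text \<open>
  Write \<open>h * lead_coeff g = r * h\<close>. Then \<open>r * (h * lead_monom g) = w\<close>, so \<open>h * lead_monom g\<close> is a scalar
  multiple of \<open>w\<close>, and the lower terms of \<open>g\<close> end up below its leading monomial \<open>w\<close>.
\<close>

lemma quotient_mult_minus_monomial:
  assumes g: "g \<noteq> 0" and h: "normalizes R h" "h * lead_term g = w" and w: "w \<in> M"
  shows "h * g - w \<in> supported (underS ord w)"
proof -
  have "h \<noteq> 0" using h(2) monomial_nonzero[OF w] by auto
  obtain r where r: "r \<in> R" "h * lead_coeff g = r * h"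
    using h(1) lead_coeff_in_R unfolding normalizes_def by blast
  have rw: "r * (h * lead_monom g) = w"
    using h(2) r(2) unfolding lt_def by (metis mult.assoc)
  have "r \<noteq> 0" using rw monomial_nonzero[OF w] by auto
  then obtain s where s: "s \<in> R" "r * s = 1" using inverse_R r by blast
  then have "s * r = 1" using commute_R r by metis
  then have "h * lead_monom g = s * w" using rw by (metis mult.assoc mult_1_left)
  moreover have "s \<noteq> 0" using s by auto
  ultimately have "lead_monom (h * lead_monom g) = w"
    using lead_monom_scaled_monomial s w by simp
  then have "h * (g - lead_term g) \<in> supported (underS ord w)"
    using normalizes_mult_supported[OF h(1) \<open>h \<noteq> 0\<close> minus_lead_term[OF g]] by simp
  then show ?thesis using h(2) by (simp add: algebra_simps)
qed

text \<open>
  For general \<open>a\<close> the coefficients of \<open>g\<close> cannot be moved past \<open>a\<close>. The monomials of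
  \<open>a * lead_term g\<close> are right divisible by \<open>lead_monom g\<close>; lifting each to a normalizing quotient and
  cancelling \<open>lead_term g\<close> decomposes \<open>a\<close> into normalizing elements. The resulting multiples of \<open>g\<close>
  have pairwise distinct leading monomials, so the largest one survives.
\<close>

lemma lead_monom_left_multiple:
  assumes g: "g \<noteq> 0" and a: "a \<noteq> 0"
  shows "right_divisible (lead_monom (a * g)) (lead_monom g)"
proof -
  let ?u = "lead_monom g" and ?x = "a * lead_term g"
  let ?F = "{w. coeff ?x w \<noteq> 0}"
  have u: "?u \<in> M" using lead_monom_in_M g by blast
  have x: "?x \<noteq> 0" using cancel_lead_term[OF g, of a 0] a by (metis mult_zero_left)
  have div: "w \<in> M \<and> right_divisible w ?u" if "w \<in> ?F" for w
    using mult_monomial_supported[OF u, of "a * lead_coeff g"] that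
    by (auto simp: supported_def lt_def mult.assoc)
  then have "\<forall>w\<in>?F. \<exists>h. normalizes R h \<and> h * lead_term g = w"
    using ex_quotient_lead_term g by blast
  from bchoice[OF this]
  obtain h where h: "\<And>w. w \<in> ?F \<Longrightarrow> normalizes R (h w) \<and> h w * lead_term g = w"
    by blast
  have expand: "(\<Sum>w\<in>?F. coeff ?x w * w) = ?x" using expansion[of ?x] by (rule sym)
  have "(\<Sum>w\<in>?F. coeff ?x w * h w) * lead_term g = (\<Sum>w\<in>?F. coeff ?x w * w)"
    unfolding sum_distrib_right mult.assoc using h by (intro sum.cong) auto
  then have "(\<Sum>w\<in>?F. coeff ?x w * h w) * lead_term g = a * lead_term g"
    by (simp only: expand)
  from cancel_lead_term[OF g this] have "a * g = (\<Sum>w\<in>?F. coeff ?x w * h w) * g" by (simp only:)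
  also have "\<dots> = (\<Sum>w\<in>?F. coeff ?x w * (h w * g))"
    by (simp add: sum_distrib_right mult.assoc)
  also have "\<dots> = (\<Sum>w\<in>?F. coeff ?x w * w) + (\<Sum>w\<in>?F. coeff ?x w * (h w * g - w))"
    by (simp add: right_diff_distrib sum_subtractf)
  also have "\<dots> = ?x + (\<Sum>w\<in>?F. coeff ?x w * (h w * g - w))"
    by (simp only: expand)
  finally have ag: "a * g = ?x + (\<Sum>w\<in>?F. coeff ?x w * (h w * g - w))" .
  define w0 where "w0 = lead_monom ?x"
  have w0: "w0 \<in> ?F" using lead_coeff_nonzero[OF x] by (simp add: lc_def w0_def)
  have lower: "(\<Sum>w\<in>?F. coeff ?x w * (h w * g - w)) \<in> supported (underS ord w0)"
  proof (rule supported_sum, rule supported_mult[OF coeff_in_R])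
    fix w assume w: "w \<in> ?F"
    have "w \<in> under ord w0"
      using w supported_under_lead[OF x] by (simp add: supported_def w0_def)
    then have "underS ord w \<subseteq> underS ord w0" using underS_mono by (simp add: under_def)
    moreover have "h w * g - w \<in> supported (underS ord w)"
      using quotient_mult_minus_monomial[OF g] h[OF w] div[OF w] by blast
    ultimately show "h w * g - w \<in> supported (underS ord w0)" using supported_mono by blast
  qed
  have "lead_monom (a * g) = w0"
  proof (rule lead_monom_eqI)
    show "coeff (a * g) w0 \<noteq> 0"
      using w0 coeff_outside[OF lower not_in_underS] by (subst ag) (simp add: coeff_add)
    show "a * g \<in> supported (under ord w0)"
      unfolding ag using supported_under_lead[OF x] supported_mono[OF lower underS_subset_under]
      by (auto simp: w0_def intro: supported_add)
  qed
  then show ?thesis using div[OF w0] by simp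
qed

text \<open>
  The bound \<open>P\<close> constrains each summand, not only the sum: representations in which terms outside \<open>P\<close>
  cancel are excluded. The support of an element may lie in a smaller \<open>P\<close> than a given representation
  shows, and closing this gap at the largest monomial is the content of the criterion.
\<close>

inductive_set combinations :: "'a set \<Rightarrow> 'a set \<Rightarrow> 'a set" for G P where
  zero: "0 \<in> combinations G P"
| add: "g \<in> G \<Longrightarrow> a * g \<in> supported P \<Longrightarrow> f \<in> combinations G P \<Longrightarrow> a * g + f \<in> combinations G P"

lemma combinations_single: "g \<in> G \<Longrightarrow> a * g \<in> supported P \<Longrightarrow> a * g \<in> combinations G P"
  using combinations.add[of g G a P 0] combinations.zero by auto

lemma combinations_add:
  "f \<in> combinations G P \<Longrightarrow> h \<in> combinations G P \<Longrightarrow> f + h \<in> combinations G P"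
  by (induction rule: combinations.induct) (auto simp: add.assoc intro: combinations.add)

lemma combinations_mult:
  assumes "f \<in> combinations G P"
    and "\<And>h. h \<in> supported P \<Longrightarrow> x * h \<in> supported Q"
  shows "x * f \<in> combinations G Q"
  using assms(1)
proof induction
  case (add g a f)
  then have "x * (a * g) \<in> supported Q" using assms(2) by blast
  then have "(x * a) * g + x * f \<in> combinations G Q"
    using add by (intro combinations.add) (auto simp: mult.assoc)
  then show ?case by (simp add: distrib_left mult.assoc)
qed (auto intro: combinations.zero)

lemma combinations_scale: "r \<in> R \<Longrightarrow> f \<in> combinations G P \<Longrightarrow> r * f \<in> combinations G P"
  using combinations_mult supported_mult by blast

lemma combinations_diff:
  assumes "f \<in> combinations G P" "h \<in> combinations G P"
  shows "f - h \<in> combinations G P"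
  using combinations_add[OF assms(1) combinations_scale[OF uminus_R[OF one_R] assms(2)]] by simp

lemma combinations_mono: "f \<in> combinations G P \<Longrightarrow> P \<subseteq> Q \<Longrightarrow> f \<in> combinations G Q"
  using combinations_mult[of f G P 1 Q] supported_mono by simp

lemma combinations_supported: "f \<in> combinations G P \<Longrightarrow> f \<in> supported P"
  by (induction rule: combinations.induct) (auto simp: supported_zero supported_add)

text \<open>
  Only finitely many summands occur, so their leading monomials have a maximum in \<open>P\<close>. This turns the
  strict bound \<open>underS ord w\<close> into a bound \<open>under ord v\<close> with \<open>v\<close> below \<open>w\<close>, to which an induction
  hypothesis applies.
\<close>

lemma combinations_bounded:
  assumes "f \<in> combinations G P" "P \<subseteq> M"
  shows "f = 0 \<or> (\<exists>w\<in>P. f \<in> combinations G (under ord w))"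
  using assms(1)
proof induction
  case (add g a f)
  show ?case
  proof (cases "a * g = 0")
    case False
    let ?u = "lead_monom (a * g)"
    have u: "?u \<in> P" using lead_monom_mem False add by blast
    have ag: "a * g \<in> supported (under ord ?u)" using supported_under_lead False by blast
    from add.IH show ?thesis
    proof
      assume "f = 0"
      then show ?thesis using combinations_single[OF add.hyps(1) ag] u by auto
    next
      assume "\<exists>w\<in>P. f \<in> combinations G (under ord w)"
      then obtain w where w: "w \<in> P" "f \<in> combinations G (under ord w)" by blast
      obtain v where v: "v \<in> {?u, w}" "{?u, w} \<subseteq> under ord v"
        using finite_has_greatest[of "{?u, w}"] u w assms(2) by auto
      have "under ord ?u \<subseteq> under ord v" "under ord w \<subseteq> under ord v"
        using v(2) under_mono by (auto simp: under_def)
      then have "a * g + f \<in> combinations G (under ord v)"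
        using combinations.add[OF add.hyps(1)] supported_mono[OF ag] combinations_mono[OF w(2)] by blast
      then show ?thesis using v(1) u w(1) by auto
    qed
  qed (use add.IH in simp)
qed simp

lemma left_ideal_hull_eq_combinations: "left_ideal hull G = combinations G M"
proof
  have "a * f \<in> combinations G M" if "f \<in> combinations G M" for a f
    using combinations_mult[OF that] supported_M by blast
  moreover have "G \<subseteq> combinations G M"
    using combinations_single[of _ G 1 M] supported_M by auto
  ultimately show "left_ideal hull G \<subseteq> combinations G M"
    by (intro hull_minimal) (auto simp: left_ideal_def combinations.zero combinations_add)
  have "f \<in> J" if "left_ideal J" "G \<subseteq> J" "f \<in> combinations G M" for f J
    using that(3,1,2) by induction (auto simp: left_ideal_def)
  then show "combinations G M \<subseteq> left_ideal hull G" unfolding hull_def by blast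
qed

lemma left_ideal_left_ideal_hull: "left_ideal (left_ideal hull G)"
  by (rule hull_in) (auto simp: left_ideal_def)

lemma s_poly_eq:
  assumes "f \<noteq> 0" "g \<noteq> 0"
    and "x * lead_term f = lcl (lead_monom f) (lead_monom g)"
    and "y * lead_term g = lcl (lead_monom f) (lead_monom g)"
  shows "s_poly f g = x * f - y * g"
proof -
  have "(THE f'. f' * lead_term f = lcl (lead_monom f) (lead_monom g)) = x"
    using assms cancel_lead_term[OF assms(1)] by (intro the_equality) auto
  moreover have "(THE g'. g' * lead_term g = lcl (lead_monom f) (lead_monom g)) = y"
    using assms cancel_lead_term[OF assms(2)] by (intro the_equality) auto
  ultimately show ?thesis by (simp add: s_poly_def Let_def)
qed

lemma s_poly_expansion:
  assumes f: "f \<noteq> 0" and g: "g \<noteq> 0"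
  obtains x y where "normalizes R x" "x * lead_term f = lcl (lead_monom f) (lead_monom g)"
    "normalizes R y" "y * lead_term g = lcl (lead_monom f) (lead_monom g)"
    "s_poly f g = x * f - y * g"
proof -
  have M: "lead_monom f \<in> M" "lead_monom g \<in> M" using lead_monom_in_M f g by auto
  obtain x where x: "normalizes R x" "x * lead_term f = lcl (lead_monom f) (lead_monom g)"
    using ex_quotient_lead_term[OF f] lcl_in_M[OF M] lcl_left[OF M] by blast
  obtain y where y: "normalizes R y" "y * lead_term g = lcl (lead_monom f) (lead_monom g)"
    using ex_quotient_lead_term[OF g] lcl_in_M[OF M] lcl_right[OF M] by blast
  show thesis using that[OF x y s_poly_eq[OF f g x(2) y(2)]] .
qed

lemma s_poly_supported:
  assumes "f \<noteq> 0" "g \<noteq> 0"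
  shows "s_poly f g \<in> supported (underS ord (lcl (lead_monom f) (lead_monom g)))"
proof -
  let ?w = "lcl (lead_monom f) (lead_monom g)"
  obtain x y where xy: "normalizes R x" "x * lead_term f = ?w" "normalizes R y"
    "y * lead_term g = ?w" and S: "s_poly f g = x * f - y * g"
    using s_poly_expansion assms by blast
  have w: "?w \<in> M" using lcl_in_M lead_monom_in_M assms by blast
  have "s_poly f g = (x * f - ?w) - (y * g - ?w)" using S by simp
  then show ?thesis
    using supported_diff[OF quotient_mult_minus_monomial[OF assms(1) xy(1,2) w]
      quotient_mult_minus_monomial[OF assms(2) xy(3,4) w]] by (simp only:)
qed

text \<open>
  A reduction to zero displays \<open>f\<close> as the sum of the subtracted multiples, and the leading monomial of
  each of them is that of the polynomial it is subtracted from.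
\<close>

lemma reduces_to_zero_combinations:
  assumes "reduces_to R M ord G f 0"
    and "f \<in> supported P" and P: "\<And>w. w \<in> P \<Longrightarrow> under ord w \<subseteq> P"
  shows "f \<in> combinations G P"
  using assms(1,2) unfolding reduces_to_def
proof (induction rule: converse_rtranclp_induct)
  case base then show ?case by (simp add: combinations.zero)
next
  case (step f f')
  then obtain g a where ga: "g \<in> G" "f \<noteq> 0" "a * g \<noteq> 0" "lead_term f = lead_term (a * g)"
    and f': "f' = f - a * g"
    unfolding reduction_step_def by blast
  have "lead_monom (a * g) = lead_monom f" using lead_monom_eq_if_lead_term_eq ga by metis
  moreover have "lead_monom f \<in> P" using lead_monom_mem ga step.prems by blast
  ultimately have ag: "a * g \<in> supported P"
    using supported_mono[OF supported_under_lead[OF ga(3)]] P by metis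
  then have "f' \<in> combinations G P" using step f' supported_diff by blast
  then have "a * g + f' \<in> combinations G P" using combinations.add ga(1) ag by blast
  then show ?case using f' by simp
qed

text \<open>
  Subtracting a multiple with the same leading term stays in the ideal and lowers the leading
  monomial.
\<close>

lemma reduces_to_zero_if_GS_basis:
  assumes G: "left_GS_basis R M ord G I" and I: "left_ideal I" and f: "f \<in> I"
  shows "reduces_to R M ord G f 0"
proof -
  have "reduces_to R M ord G f 0" if "f \<in> supported (under ord w)" "f \<in> I" for f w
    using ord_wf that
  proof (induction w arbitrary: f rule: wf_induct_rule)
    case (less w)
    show ?case
    proof (cases "f = 0")
      case True then show ?thesis by (simp add: reduces_to_def)
    next
      case False
      let ?w = "lead_monom f" and ?r = "lead_coeff f"
      have w: "?w \<in> M" using lead_monom_in_M False by blast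
      obtain g where g: "g \<in> G" "right_divisible ?w (lead_monom g)" "g \<noteq> 0" "g \<in> I"
        using G less.prems False unfolding left_GS_basis_def by blast
      obtain h where h: "normalizes R h" "h * lead_term g = ?w"
        using ex_quotient_lead_term g w by blast
      have lower: "h * g - ?w \<in> supported (underS ord ?w)"
        using quotient_mult_minus_monomial g h w by blast
      have r: "?r \<in> R" "?r \<noteq> 0" using lead_coeff_in_R lead_coeff_nonzero False by auto
      let ?q = "?r * h * g"
      have q: "?q = ?r * ?w + ?r * (h * g - ?w)" by (simp add: algebra_simps)
      have qs: "?q \<in> supported (under ord ?w)"
        unfolding q using supported_mono[OF lower underS_subset_under]
        by (intro supported_add supported_mult r supported_monomial[OF w in_under[OF w]])
      have qc: "coeff ?q ?w = ?r"
        unfolding q using r coeff_outside[OF lower not_in_underS] w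
        by (simp add: coeff_add coeff_mult_left coeff_monomial)
      have "?q \<noteq> 0" using qc r coeff_zero by metis
      moreover have "lead_monom ?q = ?w" using lead_monom_eqI qs qc r by simp
      then have "lead_term f = lead_term ?q" using qc by (simp add: lt_def lc_def)
      ultimately have step: "reduction_step R M ord g f (f - ?q)"
        unfolding reduction_step_def using False by blast
      have s: "f - ?q \<in> supported (underS ord ?w)"
        using supported_minus_top[OF supported_under_lead[OF False] qs] qc by (simp add: lc_def)
      have I': "f - ?q \<in> I"
      proof -
        have "- (?r * h) * g \<in> I" using I g(4) unfolding left_ideal_def by blast
        then have "f + - (?r * h) * g \<in> I"
          using I less.prems unfolding left_ideal_def by blast
        then show ?thesis by simp
      qed
      have "reduces_to R M ord G (f - ?q) 0"
      proof (cases "f - ?q = 0")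
        case True then show ?thesis by (simp add: reduces_to_def)
      next
        case nz: False
        let ?v = "lead_monom (f - ?q)"
        have "?v \<in> underS ord ?w" using lead_monom_mem nz s by blast
        moreover have "?w \<in> under ord w" using lead_monom_mem False less.prems by blast
        ultimately have "(?v, w) \<in> ord - Id"
          using ord_trans ord_antisym by (auto simp: under_def underS_def)
        then show ?thesis using less.IH supported_under_lead[OF nz] I' by blast
      qed
      then show ?thesis
        using step g(1) unfolding reduces_to_def
        by (intro converse_rtranclp_into_rtranclp[of _ f "f - ?q"]) blast+
    qed
  qed
  then show ?thesis
    using f supported_under_lead by (cases "f = 0") (auto simp: reduces_to_def)
qed

text \<open>
  With \<open>q\<close> a normalizing quotient of \<open>w\<close> by the least common left multiple, uniqueness of quotients by
  leading terms identifies \<open>x\<close> and \<open>y\<close> with \<open>q\<close> times the multipliers of the S-polynomial; hence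
  \<open>x * f - y * g = q * s_poly f g\<close>. As \<open>q\<close> normalizes \<open>R\<close>, it carries supports below the least common
  multiple to supports below \<open>w\<close>.
\<close>

lemma quotient_difference_combinations:
  assumes f: "f \<in> G" "f \<noteq> 0" and g: "g \<in> G" "g \<noteq> 0" and w: "w \<in> M"
    and xy: "x * lead_term f = w" "y * lead_term g = w"
    and div: "right_divisible w (lead_monom f)" "right_divisible w (lead_monom g)"
    and red: "reduces_to R M ord G (s_poly f g) 0"
  shows "x * f - y * g \<in> combinations G (underS ord w)"
proof -
  let ?L = "lcl (lead_monom f) (lead_monom g)"
  have M: "lead_monom f \<in> M" "lead_monom g \<in> M" using lead_monom_in_M f g by auto
  have L: "?L \<in> M" using lcl_in_M M by blast
  obtain q where q: "normalizes R q" "q * ?L = w"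
    using ex_normalizing_quotient[OF L w] lcl_least[OF M w div] by blast
  have "q \<noteq> 0" using q(2) monomial_nonzero[OF w] by auto
  obtain x' y' where x'y': "x' * lead_term f = ?L" "y' * lead_term g = ?L"
    and S: "s_poly f g = x' * f - y' * g"
    using s_poly_expansion f g by metis
  have "(q * x') * lead_term f = x * lead_term f" "(q * y') * lead_term g = y * lead_term g"
    using q x'y' xy by (simp_all add: mult.assoc)
  then have "q * x' = x" "q * y' = y" using cancel_lead_term f g by metis+
  then have eq: "x * f - y * g = q * s_poly f g"
    unfolding S by (simp add: right_diff_distrib flip: mult.assoc)
  have "s_poly f g \<in> combinations G (underS ord ?L)"
    using red s_poly_supported under_subset_underS f g
    by (intro reduces_to_zero_combinations) auto
  moreover have "q * h \<in> supported (underS ord w)" if "h \<in> supported (underS ord ?L)" for h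
    using normalizes_mult_supported[OF q(1) \<open>q \<noteq> 0\<close> that] lead_monom_scaled_monomial[OF one_R _ w]
      q(2) by simp
  ultimately show ?thesis unfolding eq by (rule combinations_mult)
qed

text \<open>
  A summand \<open>a * g'\<close> with coefficient \<open>r\<close> at \<open>w\<close> is replaced by \<open>r * (h * g)\<close>. The error has two
  parts: \<open>(a - r * h') * g'\<close>, in which the term at \<open>w\<close> cancels, and \<open>r\<close> times the difference of the two
  normalized multiples \<open>h' * g'\<close> and \<open>h * g\<close>, which the S-polynomial controls.
\<close>

lemma combinations_top:
  assumes G: "0 \<notin> G" and red: "\<forall>g1\<in>G. \<forall>g2\<in>G. reduces_to R M ord G (s_poly g1 g2) 0"
    and w: "w \<in> M" and f: "f \<in> combinations G (under ord w)"
    and g: "g \<in> G" "h * lead_term g = w" "right_divisible w (lead_monom g)"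
  shows "\<exists>c\<in>R. f - c * (h * g) \<in> combinations G (underS ord w)"
  using f
proof induction
  case zero
  then show ?case using zero_R combinations.zero by (intro bexI[of _ 0]) auto
next
  case (add g' a f)
  then obtain c where c: "c \<in> R" "f - c * (h * g) \<in> combinations G (underS ord w)" by blast
  let ?r = "coeff (a * g') w"
  show ?case
  proof (cases "?r = 0")
    case True
    then have "a * g' - 0 \<in> supported (underS ord w)"
      using add.hyps by (intro supported_minus_top) (auto simp: supported_zero coeff_zero)
    then have "a * g' + (f - c * (h * g)) \<in> combinations G (underS ord w)"
      using combinations.add add.hyps c by auto
    then show ?thesis using c by (auto simp: algebra_simps)
  next
    case False
    have nz: "g' \<noteq> 0" "a \<noteq> 0" "g \<noteq> 0" using False G add.hyps g by (auto simp: coeff_zero)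
    have "lead_monom (a * g') = w" using lead_monom_eqI False add.hyps by blast
    then have div: "right_divisible w (lead_monom g')"
      using lead_monom_left_multiple nz by metis
    then obtain h' where h': "normalizes R h'" "h' * lead_term g' = w"
      using ex_quotient_lead_term nz w by blast
    let ?q = "h' * g'"
    have lower: "?q - w \<in> supported (underS ord w)"
      using quotient_mult_minus_monomial nz h' w by blast
    have qs: "?r * ?q \<in> supported (under ord w)"
    proof -
      have "?q = w + (?q - w)" by simp
      then show ?thesis
        using w supported_mono[OF lower underS_subset_under]
        by (metis supported_add supported_mult coeff_in_R supported_monomial in_under)
    qed
    have "coeff ?q w = 1"
      using coeff_outside[OF lower not_in_underS] w by (simp add: coeff_diff coeff_monomial)
    then have "a * g' - ?r * ?q \<in> supported (underS ord w)"
      using add.hyps qs by (intro supported_minus_top) (auto simp: coeff_mult_left coeff_in_R)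
    then have "(a - ?r * h') * g' \<in> supported (underS ord w)"
      by (simp add: left_diff_distrib mult.assoc)
    then have 1: "(a - ?r * h') * g' \<in> combinations G (underS ord w)"
      using combinations_single add.hyps by blast
    have 2: "?r * (?q - h * g) \<in> combinations G (underS ord w)"
      using combinations_scale[OF coeff_in_R] add.hyps nz g w h' div red
      by (metis quotient_difference_combinations)
    have "a * g' + f - (?r + c) * (h * g) =
        (a - ?r * h') * g' + ?r * (?q - h * g) + (f - c * (h * g))"
      by (simp add: algebra_simps)
    then have "a * g' + f - (?r + c) * (h * g) \<in> combinations G (underS ord w)"
      using combinations_add[OF combinations_add[OF 1 2] c(2)] by (simp only:)
    then show ?thesis using add_R coeff_in_R c by blast
  qed
qed

lemma combinations_underS_if_no_divisor:
  assumes G: "0 \<notin> G" and f: "f \<in> combinations G (under ord w)"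
    and none: "\<And>g. g \<in> G \<Longrightarrow> \<not> right_divisible w (lead_monom g)"
  shows "f \<in> combinations G (underS ord w)"
  using f
proof induction
  case (add g a f)
  have "coeff (a * g) w = 0"
  proof (rule ccontr)
    assume nz: "coeff (a * g) w \<noteq> 0"
    then have "lead_monom (a * g) = w" using lead_monom_eqI add.hyps by blast
    moreover have "g \<noteq> 0" "a \<noteq> 0" using nz G add.hyps by (auto simp: coeff_zero)
    ultimately show False using lead_monom_left_multiple none add.hyps by metis
  qed
  then have "a * g - 0 \<in> supported (underS ord w)"
    using add.hyps by (intro supported_minus_top) (auto simp: supported_zero coeff_zero)
  then show ?case using combinations.add add by simp
qed (rule combinations.zero)

text \<open>
  Induction on the bound \<open>w\<close>: the coefficient \<open>c\<close> at \<open>w\<close> collected by \<open>combinations_top\<close> either is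
  nonzero, making \<open>w\<close> the leading monomial, or vanishes, so that the bound becomes strict.
\<close>

lemma lead_monom_divisible_if_s_polys_reduce:
  assumes G: "0 \<notin> G" and red: "\<forall>g1\<in>G. \<forall>g2\<in>G. reduces_to R M ord G (s_poly g1 g2) 0"
    and f: "f \<in> combinations G (under ord w)" "f \<noteq> 0" and w: "w \<in> M"
  shows "\<exists>g\<in>G. right_divisible (lead_monom f) (lead_monom g)"
  using ord_wf w f
proof (induction w arbitrary: f rule: wf_induct_rule)
  case (less w)
  have lower: ?case if small: "f \<in> combinations G (underS ord w)"
  proof -
    obtain v where v: "v \<in> underS ord w" "f \<in> combinations G (under ord v)"
      using combinations_bounded[OF small underS_subset_M] less.prems by blast
    then have "v \<in> M" "(v, w) \<in> ord - Id" using ord_in_M by (auto simp: underS_def)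
    then show ?case using less.IH v(2) less.prems by blast
  qed
  show ?case
  proof (cases "\<exists>g\<in>G. right_divisible w (lead_monom g)")
    case False
    then show ?thesis using lower combinations_underS_if_no_divisor[OF G less.prems(2)] by blast
  next
    case True
    then obtain g where g: "g \<in> G" "right_divisible w (lead_monom g)" "g \<noteq> 0" using G by metis
    then obtain h where h: "normalizes R h" "h * lead_term g = w"
      using ex_quotient_lead_term less.prems by blast
    obtain c where c: "c \<in> R" "f - c * (h * g) \<in> combinations G (underS ord w)"
      using combinations_top[OF G red less.prems(1,2) g(1) h(2) g(2)] by blast
    show ?thesis
    proof (cases "c = 0")
      case True then show ?thesis using lower c by simp
    next
      case False
      have "coeff (h * g - w) w = 0" "coeff (f - c * (h * g)) w = 0"
        using quotient_mult_minus_monomial[OF g(3) h less.prems(1)] not_in_underS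
          combinations_supported[OF c(2)] coeff_outside by blast+
      then have "coeff f w = c"
        using c(1) less.prems(1) by (simp add: coeff_diff coeff_mult_left coeff_monomial)
      then have "lead_monom f = w"
        using lead_monom_eqI False combinations_supported[OF less.prems(2)] by simp
      then show ?thesis using g by blast
    qed
  qed
qed

theorem buchberger_criterion:
  assumes G: "0 \<notin> G"
  shows "left_GS_basis R M ord G (left_ideal hull G) \<longleftrightarrow>
    (\<forall>g1\<in>G. \<forall>g2\<in>G. reduces_to R M ord G (s_poly g1 g2) 0)"
proof
  let ?I = "left_ideal hull G"
  assume GS: "left_GS_basis R M ord G ?I"
  show "\<forall>g1\<in>G. \<forall>g2\<in>G. reduces_to R M ord G (s_poly g1 g2) 0"
  proof (intro ballI)
    fix g1 g2 assume g: "g1 \<in> G" "g2 \<in> G"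
    then have "g1 \<noteq> 0" "g2 \<noteq> 0" using G by auto
    then obtain x y where "s_poly g1 g2 = x * g1 - y * g2" using s_poly_expansion by metis
    moreover have "x * g1 \<in> ?I" "y * g2 \<in> ?I"
      unfolding left_ideal_hull_eq_combinations
      using g by (auto intro: combinations_single supported_M)
    ultimately have "s_poly g1 g2 \<in> ?I"
      unfolding left_ideal_hull_eq_combinations using combinations_diff by metis
    then show "reduces_to R M ord G (s_poly g1 g2) 0"
      using reduces_to_zero_if_GS_basis GS left_ideal_left_ideal_hull by blast
  qed
next
  assume red: "\<forall>g1\<in>G. \<forall>g2\<in>G. reduces_to R M ord G (s_poly g1 g2) 0"
  have "\<exists>g\<in>G. right_divisible (lead_monom f) (lead_monom g)"
    if "f \<in> combinations G M" "f \<noteq> 0" for f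
    using combinations_bounded[OF that(1)] lead_monom_divisible_if_s_polys_reduce[OF G red] that(2)
    by blast
  then show "left_GS_basis R M ord G (left_ideal hull G)"
    unfolding left_GS_basis_def using G hull_subset[of G left_ideal]
    by (auto simp: left_ideal_hull_eq_combinations)
qed

end

section \<open>Power products of commuting elements\<close>

lemma power_product_0: "power_product 0 X \<alpha> = 1"
  by (simp add: power_product_def)

lemma power_product_Suc:
  "power_product (Suc m) X \<alpha> = power_product m X \<alpha> * X (Suc m) ^ \<alpha> (Suc m)"
  by (simp add: power_product_def)

lemma power_product_commute:
  assumes "\<And>i. i \<in> {1..m} \<Longrightarrow> y * X i = X i * y"
  shows "y * power_product m X \<alpha> = power_product m X \<alpha> * y"
  using assms
proof (induction m)
  case (Suc m)
  have top: "y * X (Suc m) ^ \<alpha> (Suc m) = X (Suc m) ^ \<alpha> (Suc m) * y"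
    by (rule power_commuting_commutes[symmetric]) (simp add: Suc.prems)
  have IH: "y * power_product m X \<alpha> = power_product m X \<alpha> * y" using Suc by simp
  have "y * power_product (Suc m) X \<alpha> = power_product m X \<alpha> * (y * X (Suc m) ^ \<alpha> (Suc m))"
    unfolding power_product_Suc by (simp add: IH flip: mult.assoc)
  then show ?case unfolding top power_product_Suc by (simp add: mult.assoc)
qed (simp add: power_product_0)

lemma power_product_add:
  assumes "\<And>i j. i \<in> {1..m} \<Longrightarrow> j \<in> {1..m} \<Longrightarrow> X i * X j = X j * X i"
  shows "power_product m X (\<lambda>i. \<alpha> i + \<beta> i) = power_product m X \<alpha> * power_product m X \<beta>"
  using assms
proof (induction m)
  case (Suc m)
  have comm: "X (Suc m) ^ \<alpha> (Suc m) * power_product m X \<beta> = power_product m X \<beta> * X (Suc m) ^ \<alpha> (Suc m)"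
    by (rule power_product_commute, rule power_commuting_commutes) (simp add: Suc.prems)
  have "power_product (Suc m) X (\<lambda>i. \<alpha> i + \<beta> i) =
      power_product m X \<alpha> * (power_product m X \<beta> * X (Suc m) ^ \<alpha> (Suc m)) * X (Suc m) ^ \<beta> (Suc m)"
    using Suc by (simp add: power_product_Suc power_add mult.assoc)
  then show ?case by (simp add: power_product_Suc mult.assoc flip: comm)
qed (simp add: power_product_0)

lemma power_product_induct:
  assumes "P 1" "\<And>x i. P x \<Longrightarrow> i \<in> {1..m} \<Longrightarrow> P (x * X i)"
  shows "P (power_product m X \<alpha>)"
  using assms(2)
proof (induction m)
  case (Suc m)
  have "P (power_product m X \<alpha> * X (Suc m) ^ k)" for k
    using Suc by (induction k) (auto simp: power_Suc2 simp flip: mult.assoc simp del: power_Suc)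
  then show ?case by (simp add: power_product_Suc)
qed (simp add: power_product_0 assms(1))

lemma power_product_zero: "(\<And>i. i \<in> {1..m} \<Longrightarrow> \<alpha> i = 0) \<Longrightarrow> power_product m X \<alpha> = 1"
  by (induction m) (auto simp: power_product_0 power_product_Suc)

lemma power_product_single:
  "j \<in> {1..m} \<Longrightarrow> power_product m X (\<lambda>i. if i = j then 1 else 0) = X j"
proof (induction m)
  case (Suc m)
  show ?case
  proof (cases "j = Suc m")
    case True
    then show ?thesis using power_product_zero[of m "\<lambda>i. if i = j then 1 else 0" X]
      by (auto simp: power_product_Suc)
  qed (use Suc in \<open>auto simp: power_product_Suc\<close>)
qed simp

section \<open>Derivations of finite extensions in characteristic zero\<close>

locale finite_extension_algebra = unital_algebra scale
  for scale :: "'k::field_char_0 \<Rightarrow> 'a::ring_1 \<Rightarrow> 'a" +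
  fixes R :: "'a set"
  assumes finite_extension: "finite_field_extension scale R"
begin

lemma subspace_R: "subspace R"
  and one_in_R: "1 \<in> R"
  and mult_in_R: "a \<in> R \<Longrightarrow> b \<in> R \<Longrightarrow> a * b \<in> R"
  and commute_in_R: "a \<in> R \<Longrightarrow> b \<in> R \<Longrightarrow> a * b = b * a"
  and inverse_in_R: "a \<in> R \<Longrightarrow> a \<noteq> 0 \<Longrightarrow> \<exists>b\<in>R. a * b = 1"
  and finite_span_R: "\<exists>B. finite B \<and> span B = R"
  using finite_extension unfolding finite_field_extension_def subalgebra_def by blast+

lemma power_in_R: "r \<in> R \<Longrightarrow> r ^ i \<in> R"
  by (induction i) (auto simp: one_in_R mult_in_R)

text \<open>
  The indices carry the coefficients, so that a coincidence \<open>r ^ i = r ^ j\<close> also counts as a dependency.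
\<close>

lemma powers_dependent:
  assumes r: "r \<in> R"
  shows "\<exists>N c. (\<Sum>i\<le>N. scale (c i) (r ^ i)) = 0 \<and> (\<exists>i\<le>N. c i \<noteq> 0)"
proof -
  obtain B where B: "finite B" "span B = R" using finite_span_R by blast
  let ?N = "card B"
  show ?thesis
  proof (cases "inj_on (\<lambda>i. r ^ i) {..?N}")
    case True
    let ?S = "(\<lambda>i. r ^ i) ` {..?N}"
    have "card ?S = Suc ?N" using True by (simp add: card_image)
    moreover have "?S \<subseteq> span B" using B power_in_R r by auto
    ultimately have "dependent ?S" using independent_span_bound[OF B(1), of ?S] by auto
    then obtain u v where u: "v \<in> ?S" "u v \<noteq> 0" "(\<Sum>v\<in>?S. scale (u v) v) = 0"
      using dependent_finite[of ?S] by auto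
    have "(\<Sum>i\<le>?N. scale (u (r ^ i)) (r ^ i)) = 0"
      using u(3) sum.reindex[OF True, of "\<lambda>v. scale (u v) v"] by simp
    then show ?thesis using u(1,2) by (intro exI[of _ ?N] exI[of _ "\<lambda>i. u (r ^ i)"]) auto
  next
    case False
    then obtain i j where "i \<noteq> j" "r ^ i = r ^ j" unfolding inj_on_def by blast
    then obtain i j where ij: "i < j" "r ^ i = r ^ j" by (cases i j rule: linorder_cases) auto
    let ?c = "\<lambda>k. if k = j then 1 else if k = i then - 1 else 0"
    have "(\<Sum>k\<le>j. scale (?c k) (r ^ k)) = (\<Sum>k\<in>{i, j}. scale (?c k) (r ^ k))"
      using ij by (intro sum.mono_neutral_right) auto
    also have "\<dots> = 0" using ij by simp
    finally show ?thesis by (intro exI[of _ j] exI[of _ ?c]) auto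
  qed
qed

text \<open>
  Take a nontrivial relation \<open>p(r) = 0\<close> over \<open>k\<close> of least degree. Applying \<open>d\<close> gives \<open>p'(r) d(r) = 0\<close>. In
  characteristic zero \<open>p'\<close> is a nontrivial polynomial of smaller degree, so \<open>p'(r) \<noteq> 0\<close> by minimality,
  and it is invertible in \<open>R\<close>.
\<close>

lemma derivation_eq_zero:
  assumes d: "derivation_on scale R d" and r: "r \<in> R"
  shows "d r = 0"
proof -
  have d_R: "\<And>a. a \<in> R \<Longrightarrow> d a \<in> R"
    and d_add: "\<And>a b. a \<in> R \<Longrightarrow> b \<in> R \<Longrightarrow> d (a + b) = d a + d b"
    and d_scale: "\<And>c a. a \<in> R \<Longrightarrow> d (scale c a) = scale c (d a)"
    and d_mult: "\<And>a b. a \<in> R \<Longrightarrow> b \<in> R \<Longrightarrow> d (a * b) = a * d b + d a * b"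
    using d unfolding derivation_on_def by auto
  have d_zero: "d 0 = 0" using d_scale[OF one_in_R, of 0] by simp
  have d_one: "d 1 = 0" using d_mult[OF one_in_R one_in_R] by simp
  have d_sum: "d (\<Sum>i\<in>F. x i) = (\<Sum>i\<in>F. d (x i))" if "\<And>i. x i \<in> R" for x :: "nat \<Rightarrow> 'a" and F
  proof (induction F rule: infinite_finite_induct)
    case (insert i F)
    then show ?case using d_add[OF that subspace_sum[OF subspace_R, of F x]] that by simp
  qed (simp_all add: d_zero)
  have d_power: "d (r ^ Suc i) = scale (of_nat (Suc i)) (r ^ i) * d r" for i
  proof (induction i)
    case 0 then show ?case by (simp add: scale_mult_left)
  next
    case (Suc i)
    have "d (r ^ Suc (Suc i)) = r * d (r ^ Suc i) + d r * r ^ Suc i"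
      using d_mult[OF r power_in_R[OF r, of "Suc i"]] by simp
    also have "\<dots> = scale (of_nat (Suc i)) (r ^ Suc i * d r) + r ^ Suc i * d r"
      unfolding Suc commute_in_R[OF d_R[OF r] power_in_R[OF r]]
      by (simp add: scale_mult_left scale_mult_right mult.assoc)
    also have "\<dots> = scale (of_nat (Suc i) + 1) (r ^ Suc i * d r)"
      by (simp only: scale_left_distrib scale_one)
    also have "\<dots> = scale (of_nat (Suc (Suc i))) (r ^ Suc i) * d r"
      by (simp add: scale_mult_left add_ac)
    finally show ?case .
  qed
  let ?P = "\<lambda>N. \<exists>c. (\<Sum>i\<le>N. scale (c i) (r ^ i)) = 0 \<and> (\<exists>i\<le>N. c i \<noteq> 0)"
  define N where "N = (LEAST N. ?P N)"
  have "?P N" unfolding N_def by (rule LeastI_ex[of ?P]) (rule powers_dependent[OF r])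
  have least: "\<not> ?P k" if "k < N" for k using not_less_Least[of k ?P] that N_def by blast
  obtain c where c: "(\<Sum>i\<le>N. scale (c i) (r ^ i)) = 0" "\<exists>i\<le>N. c i \<noteq> 0" using \<open>?P N\<close> by blast
  have "N \<noteq> 0" using c by (cases N) auto
  then obtain k where k: "N = Suc k" using not0_implies_Suc by blast
  have "c N \<noteq> 0"
  proof
    assume "c N = 0"
    then have "(\<Sum>i\<le>k. scale (c i) (r ^ i)) = 0" "\<exists>i\<le>k. c i \<noteq> 0"
      using c by (auto simp: k le_Suc_eq)
    then show False using least[of k] k by blast
  qed
  \<comment> \<open>\<open>q\<close> is the value at \<open>r\<close> of the derivative of the relation.\<close>
  define q where "q = (\<Sum>i\<le>k. scale (c (Suc i) * of_nat (Suc i)) (r ^ i))"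
  have q_R: "q \<in> R" unfolding q_def
    by (intro subspace_sum subspace_scale subspace_R power_in_R r)
  have "q \<noteq> 0"
  proof
    assume "q = 0"
    moreover have "c (Suc k) * of_nat (Suc k) \<noteq> 0" using \<open>c N \<noteq> 0\<close> k by (simp del: of_nat_Suc)
    ultimately have "?P k"
      unfolding q_def by (intro exI[of _ "\<lambda>i. c (Suc i) * of_nat (Suc i)"] conjI exI[of _ k]) simp_all
    then show False using least[of k] k by blast
  qed
  have "0 = d (\<Sum>i\<le>N. scale (c i) (r ^ i))" using c d_zero by simp
  also have "\<dots> = (\<Sum>i\<le>N. scale (c i) (d (r ^ i)))"
    by (subst d_sum) (auto intro!: subspace_scale subspace_R power_in_R r simp: d_scale power_in_R r)
  also have "\<dots> = (\<Sum>i\<le>k. scale (c (Suc i)) (d (r ^ Suc i)))"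
    unfolding k sum.atMost_Suc_shift by (simp add: d_one del: power_Suc)
  also have "\<dots> = q * d r"
    unfolding q_def d_power sum_distrib_right by (simp add: scale_mult_left)
  finally have qd: "q * d r = 0" by simp
  obtain b where b: "b \<in> R" "q * b = 1" using inverse_in_R[OF q_R \<open>q \<noteq> 0\<close>] by blast
  have "d r = b * q * d r" using b commute_in_R[OF b(1) q_R] by simp
  then show "d r = 0" using qd by (simp add: mult.assoc)
qed

end

section \<open>Differential difference algebras over a finite extension\<close>

locale dd_finite_extension = dd_algebra scale R m n S D \<sigma> \<delta> + finite_extension_algebra scale R
  for scale :: "'k::field_char_0 \<Rightarrow> 'a::ring_1 \<Rightarrow> 'a" and R m n S D \<sigma> \<delta>
begin

abbreviation M :: "'a set" where "M \<equiv> std_monomials m n S D"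
abbreviation S_power :: "(nat \<Rightarrow> nat) \<Rightarrow> 'a" where "S_power \<equiv> power_product m S"
abbreviation D_power :: "(nat \<Rightarrow> nat) \<Rightarrow> 'a" where "D_power \<equiv> power_product n D"

lemma M_iff: "u \<in> M \<longleftrightarrow> (\<exists>\<alpha>\<in>exponents m. \<exists>\<beta>\<in>exponents n. u = S_power \<alpha> * D_power \<beta>)"
  by (auto simp: std_monomials_def std_monomial_def)

lemma monomial_eqD:
  assumes "S_power \<alpha> * D_power \<beta> = S_power \<mu> * D_power \<nu>"
    and "\<alpha> \<in> exponents m" "\<beta> \<in> exponents n" "\<mu> \<in> exponents m" "\<nu> \<in> exponents n"
  shows "\<alpha> = \<mu>" "\<beta> = \<nu>"
  using inj_onD[OF inj_std_monomial, of "(\<alpha>, \<beta>)" "(\<mu>, \<nu>)"] assms by (auto simp: std_monomial_def)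

sublocale left_basis R M
  using subspace_R one_in_R mult_in_R commute_in_R inverse_in_R basis
  by unfold_locales (auto intro: subspace_add subspace_neg)

definition B :: "'a set" where "B = generated_subalgebra scale (R \<union> D ` {1..n})"

lemma subalgebraI:
  assumes "0 \<in> C" "1 \<in> C" "\<And>x y. x \<in> C \<Longrightarrow> y \<in> C \<Longrightarrow> x + y \<in> C"
    "\<And>c x. x \<in> C \<Longrightarrow> scale c x \<in> C" "\<And>x y. x \<in> C \<Longrightarrow> y \<in> C \<Longrightarrow> x * y \<in> C"
  shows "subalgebra scale C"
  using assms by (auto simp: subalgebra_def subspace_def)

lemma subalgebra_B: "subalgebra scale B"
  unfolding B_def generated_subalgebra_def
  by (rule hull_in) (auto simp: subalgebra_def subspace_def)

lemma B_subset: "subalgebra scale C \<Longrightarrow> R \<subseteq> C \<Longrightarrow> D ` {1..n} \<subseteq> C \<Longrightarrow> B \<subseteq> C"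
  unfolding B_def generated_subalgebra_def by (rule hull_minimal) auto

lemma R_subset_B: "R \<subseteq> B" and D_in_B: "i \<in> {1..n} \<Longrightarrow> D i \<in> B"
  unfolding B_def generated_subalgebra_def by (auto intro: hull_inc)

lemma one_in_B: "1 \<in> B" and mult_in_B: "x \<in> B \<Longrightarrow> y \<in> B \<Longrightarrow> x * y \<in> B"
  and add_in_B: "x \<in> B \<Longrightarrow> y \<in> B \<Longrightarrow> x + y \<in> B" and zero_in_B: "0 \<in> B"
  and scale_in_B: "x \<in> B \<Longrightarrow> scale c x \<in> B"
  using subalgebra_B by (auto simp: subalgebra_def subspace_def)

lemma D_power_in_B: "D_power \<beta> \<in> B"
  by (rule power_product_induct) (auto simp: one_in_B mult_in_B D_in_B)

lemma D_commute_R: "i \<in> {1..n} \<Longrightarrow> r \<in> R \<Longrightarrow> D i * r = r * D i"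
  using D_mult derivation_eq_zero[OF derivation] by simp

text \<open>
  Two passes through the generators: first every element of \<open>B\<close> commutes with the generators, then
  the centralizer of \<open>B\<close> contains the generators and therefore \<open>B\<close>.
\<close>

lemma B_commutative:
  assumes "x \<in> B" "y \<in> B"
  shows "x * y = y * x"
proof -
  have centralizer: "subalgebra scale {x. \<forall>y\<in>Y. x * y = y * x}" for Y :: "'a set"
    by (rule subalgebraI)
      (auto simp: distrib_left distrib_right scale_mult_left scale_mult_right,
        metis mult.assoc)
  let ?X = "R \<union> D ` {1..n}"
  have "B \<subseteq> {x. \<forall>y\<in>?X. x * y = y * x}"
    using commute_in_R D_commute_R D_commute by (intro B_subset centralizer) auto
  then have "B \<subseteq> {x. \<forall>y\<in>B. x * y = y * x}"
    by (intro B_subset centralizer) (auto dest: subsetD)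
  then show ?thesis using assms by blast
qed

text \<open>
  As \<open>\<sigma> j\<close> is a homomorphism, the elements satisfying the identity form a subalgebra, and the identity
  holds on generators: on \<open>R\<close> it rewrites \<open>S\<^sub>j r = \<sigma>\<^sub>j\<^sup>-\<^sup>1(r) S\<^sub>j\<close>, on the \<open>D\<^sub>i\<close> it is a defining relation.
\<close>

lemma shift_S:
  assumes j: "j \<in> {1..m}" and x: "x \<in> B"
  shows "x * S j = S j * \<sigma> j x"
proof -
  have \<sigma>: "\<And>a b. a \<in> B \<Longrightarrow> b \<in> B \<Longrightarrow> \<sigma> j (a + b) = \<sigma> j a + \<sigma> j b"
    "\<And>a b. a \<in> B \<Longrightarrow> b \<in> B \<Longrightarrow> \<sigma> j (a * b) = \<sigma> j a * \<sigma> j b"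
    "\<And>c a. a \<in> B \<Longrightarrow> \<sigma> j (scale c a) = scale c (\<sigma> j a)" "\<sigma> j 1 = 1"
    using automorphism[OF j] unfolding algebra_automorphism_on_def B_def by auto
  have \<sigma>0: "\<sigma> j 0 = 0" using \<sigma>(3)[OF one_in_B, of 0] by simp
  have \<sigma>R: "bij_betw (\<sigma> j) R R"
    using automorphism_R[OF j] unfolding algebra_automorphism_on_def by auto
  let ?C = "{x \<in> B. x * S j = S j * \<sigma> j x}"
  have "subalgebra scale ?C"
  proof (rule subalgebraI)
    fix a b assume ab: "a \<in> ?C" "b \<in> ?C"
    then have "a * b * S j = S j * (\<sigma> j a * \<sigma> j b)"
      by (simp add: mult.assoc) (simp flip: mult.assoc)
    then show "a * b \<in> ?C" using ab \<sigma>(2) mult_in_B by auto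
    show "a + b \<in> ?C" using ab \<sigma>(1) add_in_B by (simp add: algebra_simps)
  next
    fix c a assume "a \<in> ?C"
    then show "scale c a \<in> ?C" using \<sigma>(3) scale_in_B by (simp add: scale_mult_left scale_mult_right)
  qed (auto simp: zero_in_B one_in_B \<sigma>0 \<sigma>(4))
  moreover have "R \<subseteq> ?C"
  proof
    fix r assume r: "r \<in> R"
    then have "\<sigma> j r \<in> R" using \<sigma>R by (auto simp: bij_betw_def)
    then have "S j * \<sigma> j r = r * S j"
      using S_mult[OF j] the_inv_into_f_f[of "\<sigma> j" R r] \<sigma>R r by (simp add: bij_betw_def)
    then show "r \<in> ?C" using R_subset_B r by auto
  qed
  ultimately have "B \<subseteq> ?C" using D_S[OF _ j] D_in_B by (intro B_subset) auto
  then show ?thesis using x by blast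
qed

text \<open>
  The set equality \<open>B S\<^sup>\<alpha> = S\<^sup>\<alpha> B\<close>. One inclusion moves powers of the \<open>S\<^sub>j\<close> to the left, to expand
  products; the other, which needs surjectivity of the \<open>\<sigma>\<^sub>j\<close>, produces quotients.
\<close>

lemma B_mult_S_power:
  shows "(\<forall>x\<in>B. \<exists>y\<in>B. x * S_power \<alpha> = S_power \<alpha> * y) \<and> (\<forall>y\<in>B. \<exists>x\<in>B. x * S_power \<alpha> = S_power \<alpha> * y)"
    (is "?P (S_power \<alpha>)")
proof (rule power_product_induct[where P = ?P])
  fix s j assume s: "?P s" and j: "j \<in> {1..m}"
  have bij: "bij_betw (\<sigma> j) B B"
    using automorphism[OF j] unfolding algebra_automorphism_on_def B_def by auto
  show "?P (s * S j)"
  proof (intro conjI ballI)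
    fix x assume "x \<in> B"
    then obtain y where y: "y \<in> B" "x * s = s * y" using s by blast
    then have "x * (s * S j) = s * S j * \<sigma> j y"
      using shift_S[OF j y(1)] by (metis mult.assoc)
    moreover have "\<sigma> j y \<in> B" using bij y by (auto simp: bij_betw_def)
    ultimately show "\<exists>y\<in>B. x * (s * S j) = s * S j * y" by blast
  next
    fix y assume "y \<in> B"
    then obtain z where z: "z \<in> B" "y = \<sigma> j z" using bij by (auto simp: bij_betw_def)
    obtain x where x: "x \<in> B" "x * s = s * z" using s z by blast
    then have "x * (s * S j) = s * S j * y"
      using shift_S[OF j z(1)] z(2) by (metis mult.assoc)
    then show "\<exists>x\<in>B. x * (s * S j) = s * S j * y" using x by blast
  qed
qed auto

lemma normalizes_S_power: "normalizes R (S_power \<alpha>)"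
proof (rule power_product_induct)
  fix x j assume x: "normalizes R x" and j: "j \<in> {1..m}"
  have "normalizes R (S j)"
    unfolding normalizes_def
  proof
    fix r assume r: "r \<in> R"
    have "bij_betw (\<sigma> j) R R" using automorphism_R[OF j] unfolding algebra_automorphism_on_def by auto
    then have "the_inv_into R (\<sigma> j) r \<in> R"
      using the_inv_into_into[of "\<sigma> j" R r R] r by (auto simp: bij_betw_def)
    then show "\<exists>r'\<in>R. S j * r = r' * S j" using S_mult[OF j r] by blast
  qed
  with x show "normalizes R (x * S j)" by (rule normalizes_mult)
qed (rule normalizes_one)

lemma normalizes_B: "y \<in> B \<Longrightarrow> normalizes R y"
  unfolding normalizes_def using B_commutative R_subset_B by blast

lemma S_power_add: "S_power (\<lambda>i. \<alpha> i + \<beta> i) = S_power \<alpha> * S_power \<beta>"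
  by (rule power_product_add) (rule S_commute)

lemma D_power_add: "D_power (\<lambda>i. \<alpha> i + \<beta> i) = D_power \<alpha> * D_power \<beta>"
  by (rule power_product_add) (rule D_commute)

definition multiples :: "(nat \<Rightarrow> nat) \<Rightarrow> (nat \<Rightarrow> nat) \<Rightarrow> 'a set" where
  "multiples \<alpha> \<beta> = {S_power \<mu> * D_power \<nu> |\<mu> \<nu>.
     \<mu> \<in> exponents m \<and> \<nu> \<in> exponents n \<and> \<alpha> \<le> \<mu> \<and> \<beta> \<le> \<nu>}"

lemma multiplesI: "\<mu> \<in> exponents m \<Longrightarrow> \<nu> \<in> exponents n \<Longrightarrow> \<alpha> \<le> \<mu> \<Longrightarrow> \<beta> \<le> \<nu>
  \<Longrightarrow> S_power \<mu> * D_power \<nu> \<in> multiples \<alpha> \<beta>"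
  unfolding multiples_def by blast

lemma multiples_subset: "multiples \<alpha> \<beta> \<subseteq> M"
  unfolding multiples_def M_iff subset_iff by blast

lemma supported_mult_right_expansion:
  assumes "\<And>v. coeff x v \<noteq> 0 \<Longrightarrow> v * y \<in> supported P"
  shows "x * y \<in> supported P"
proof -
  have "x * y = (\<Sum>v | coeff x v \<noteq> 0. coeff x v * (v * y))"
    by (subst (1) expansion[of x]) (simp add: sum_distrib_right mult.assoc)
  also have "\<dots> \<in> supported P"
    using assms by (intro supported_sum supported_mult[OF coeff_in_R]) simp
  finally show ?thesis .
qed

lemma multiples_mult_D:
  assumes "u \<in> multiples \<alpha> \<beta>" "j \<in> {1..n}"
  shows "u * D j \<in> multiples \<alpha> \<beta>"
proof -
  let ?e = "\<lambda>i. if i = j then 1 else 0"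
  obtain \<mu> \<nu> where u: "u = S_power \<mu> * D_power \<nu>" "\<mu> \<in> exponents m" "\<nu> \<in> exponents n" "\<alpha> \<le> \<mu>" "\<beta> \<le> \<nu>"
    using assms(1) unfolding multiples_def by auto
  have "\<beta> \<le> (\<lambda>i. \<nu> i + ?e i)" using u(5) by (auto simp: le_fun_def intro: le_SucI)
  moreover have "(\<lambda>i. \<nu> i + ?e i) \<in> exponents n" using u(3) assms(2) by (auto simp: exponents_def)
  moreover have "u * D j = S_power \<mu> * D_power (\<lambda>i. \<nu> i + ?e i)"
    unfolding u(1) D_power_add power_product_single[OF assms(2)] by (simp add: mult.assoc)
  ultimately show ?thesis using multiplesI u by simp
qed

text \<open>
  The elements \<open>y\<close> that preserve this left \<open>R\<close>-module under right multiplication form a subalgebra, so it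
  is enough to check the generators of \<open>B\<close>. Working on the right avoids an explicit description
  of \<open>B\<close> by polynomials in the \<open>D\<^sub>i\<close>.
\<close>

lemma supported_multiples_mult_B:
  assumes "z \<in> supported (multiples \<alpha> \<beta>)" "y \<in> B"
  shows "z * y \<in> supported (multiples \<alpha> \<beta>)"
proof -
  let ?N = "supported (multiples \<alpha> \<beta>)"
  let ?C = "{y. \<forall>z\<in>?N. z * y \<in> ?N}"
  have "subalgebra scale ?C"
  proof (rule subalgebraI)
    fix c y assume y: "y \<in> ?C"
    have "z * scale c y = scale c 1 * (z * y)" for z
      by (simp add: scale_mult_left scale_mult_right)
    moreover have "scale c 1 \<in> R" using subspace_scale subspace_R one_in_R by blast
    ultimately show "scale c y \<in> ?C" using y supported_mult by auto
  qed (auto simp: supported_zero distrib_left supported_add simp flip: mult.assoc)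
  moreover have "R \<subseteq> ?C"
  proof (intro subsetI CollectI ballI)
    fix r z assume r: "r \<in> R" and z: "z \<in> ?N"
    show "z * r \<in> ?N"
    proof (rule supported_mult_right_expansion)
      fix v assume "coeff z v \<noteq> 0"
      then have v: "v \<in> multiples \<alpha> \<beta>" using z by (auto simp: supported_def)
      then obtain \<mu> \<nu> where "v = S_power \<mu> * D_power \<nu>" unfolding multiples_def by auto
      then have "normalizes R v"
        using normalizes_mult normalizes_S_power normalizes_B D_power_in_B by blast
      then obtain r' where "r' \<in> R" "v * r = r' * v" using r unfolding normalizes_def by blast
      moreover have "v \<in> ?N" using supported_monomial v multiples_subset by blast
      ultimately show "v * r \<in> ?N" using supported_mult by simp
    qed
  qed
  moreover have "D ` {1..n} \<subseteq> ?C"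
  proof (clarsimp, rule supported_mult_right_expansion)
    fix j z v assume "Suc 0 \<le> j" "j \<le> n" "z \<in> ?N" "coeff z v \<noteq> 0"
    then have "v * D j \<in> multiples \<alpha> \<beta>"
      using multiples_mult_D[of v \<alpha> \<beta> j] by (auto simp: supported_def)
    then show "v * D j \<in> ?N" using supported_monomial multiples_subset by blast
  qed
  ultimately have "B \<subseteq> ?C" by (rule B_subset)
  then show ?thesis using assms by blast
qed

text \<open>
  For a monomial \<open>S\<^sup>\<gamma> D\<^sup>\<eta>\<close> in \<open>x\<close>, choose \<open>y \<in> B\<close> with \<open>D\<^sup>\<eta> S\<^sup>\<alpha> = S\<^sup>\<alpha> y\<close>. As \<open>B\<close> is commutative, the product
  becomes \<open>S\<^sup>\<gamma>\<^sup>+\<^sup>\<alpha> D\<^sup>\<beta> y\<close>, a right \<open>B\<close>-multiple of a dominating monomial.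
\<close>

lemma mult_supported_multiples:
  assumes \<alpha>: "\<alpha> \<in> exponents m" and \<beta>: "\<beta> \<in> exponents n"
  shows "x * (S_power \<alpha> * D_power \<beta>) \<in> supported (multiples \<alpha> \<beta>)"
proof (rule supported_mult_right_expansion)
  fix v assume "coeff x v \<noteq> 0"
  then obtain \<gamma> \<eta> where v: "v = S_power \<gamma> * D_power \<eta>" "\<gamma> \<in> exponents m" "\<eta> \<in> exponents n"
    using coeff_in_M M_iff by blast
  obtain y where y: "y \<in> B" "D_power \<eta> * S_power \<alpha> = S_power \<alpha> * y"
    using B_mult_S_power D_power_in_B by blast
  have "v * (S_power \<alpha> * D_power \<beta>) = S_power \<gamma> * (D_power \<eta> * S_power \<alpha>) * D_power \<beta>"
    unfolding v by (simp add: mult.assoc)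
  also have "\<dots> = S_power \<gamma> * S_power \<alpha> * (y * D_power \<beta>)"
    unfolding y(2) by (simp add: mult.assoc)
  also have "\<dots> = S_power (\<lambda>i. \<gamma> i + \<alpha> i) * D_power \<beta> * y"
    unfolding S_power_add B_commutative[OF y(1) D_power_in_B] by (simp add: mult.assoc)
  finally have eq: "v * (S_power \<alpha> * D_power \<beta>) = S_power (\<lambda>i. \<gamma> i + \<alpha> i) * D_power \<beta> * y" .
  have "S_power (\<lambda>i. \<gamma> i + \<alpha> i) * D_power \<beta> \<in> multiples \<alpha> \<beta>"
    using \<alpha> \<beta> v(2) by (intro multiplesI) (auto simp: exponents_def le_fun_def)
  then have "S_power (\<lambda>i. \<gamma> i + \<alpha> i) * D_power \<beta> \<in> supported (multiples \<alpha> \<beta>)"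
    using supported_monomial multiples_subset by blast
  then show "v * (S_power \<alpha> * D_power \<beta>) \<in> supported (multiples \<alpha> \<beta>)"
    unfolding eq using supported_multiples_mult_B y(1) by blast
qed

text \<open>
  The quotient is \<open>S\<^sup>\<mu>\<^sup>-\<^sup>\<alpha> y\<close>, where \<open>y \<in> B\<close> is the preimage of \<open>D\<^sup>\<nu>\<^sup>-\<^sup>\<beta>\<close> under moving past \<open>S\<^sup>\<alpha>\<close>, that is
  \<open>y S\<^sup>\<alpha> = S\<^sup>\<alpha> D\<^sup>\<nu>\<^sup>-\<^sup>\<beta>\<close>.
\<close>

lemma ex_normalizing_monomial_quotient:
  assumes "\<alpha> \<le> \<mu>" "\<beta> \<le> \<nu>"
  shows "\<exists>h. normalizes R h \<and> h * (S_power \<alpha> * D_power \<beta>) = S_power \<mu> * D_power \<nu>"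
proof -
  let ?\<gamma> = "\<lambda>i. \<mu> i - \<alpha> i" and ?\<eta> = "\<lambda>i. \<nu> i - \<beta> i"
  obtain y where y: "y \<in> B" "y * S_power \<alpha> = S_power \<alpha> * D_power ?\<eta>"
    using B_mult_S_power D_power_in_B by blast
  have "S_power ?\<gamma> * y * (S_power \<alpha> * D_power \<beta>) = S_power ?\<gamma> * (y * S_power \<alpha>) * D_power \<beta>"
    by (simp add: mult.assoc)
  also have "\<dots> = (S_power ?\<gamma> * S_power \<alpha>) * (D_power ?\<eta> * D_power \<beta>)"
    unfolding y(2) by (simp add: mult.assoc)
  also have "\<dots> = S_power (\<lambda>i. ?\<gamma> i + \<alpha> i) * D_power (\<lambda>i. ?\<eta> i + \<beta> i)"
    by (simp only: S_power_add D_power_add)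
  also have "\<dots> = S_power \<mu> * D_power \<nu>" using assms by (simp add: le_fun_def)
  finally show ?thesis
    using normalizes_mult[OF normalizes_S_power normalizes_B[OF y(1)]] by blast
qed

lemma right_divisible_iff:
  assumes "\<alpha> \<in> exponents m" "\<beta> \<in> exponents n" "\<mu> \<in> exponents m" "\<nu> \<in> exponents n"
  shows "right_divisible (S_power \<mu> * D_power \<nu>) (S_power \<alpha> * D_power \<beta>) \<longleftrightarrow> \<alpha> \<le> \<mu> \<and> \<beta> \<le> \<nu>"
proof
  assume "right_divisible (S_power \<mu> * D_power \<nu>) (S_power \<alpha> * D_power \<beta>)"
  then obtain h where h: "S_power \<mu> * D_power \<nu> = h * (S_power \<alpha> * D_power \<beta>)"
    unfolding right_divisible_def by blast
  have "S_power \<mu> * D_power \<nu> \<in> supported (multiples \<alpha> \<beta>)"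
    unfolding h by (rule mult_supported_multiples[OF assms(1,2)])
  moreover have "S_power \<mu> * D_power \<nu> \<in> M" using assms M_iff by blast
  ultimately have "S_power \<mu> * D_power \<nu> \<in> multiples \<alpha> \<beta>"
    by (auto simp: supported_def coeff_monomial)
  then show "\<alpha> \<le> \<mu> \<and> \<beta> \<le> \<nu>"
    unfolding multiples_def using monomial_eqD assms(3,4) by blast
next
  assume "\<alpha> \<le> \<mu> \<and> \<beta> \<le> \<nu>"
  then show "right_divisible (S_power \<mu> * D_power \<nu>) (S_power \<alpha> * D_power \<beta>)"
    unfolding right_divisible_def using ex_normalizing_monomial_quotient by metis
qed

lemma lclm_monomial_eq:
  assumes "\<alpha> \<in> exponents m" "\<beta> \<in> exponents n" "\<mu> \<in> exponents m" "\<nu> \<in> exponents n"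
  shows "lclm_monomial m n S D (S_power \<alpha> * D_power \<beta>) (S_power \<mu> * D_power \<nu>) =
    S_power (\<lambda>i. max (\<alpha> i) (\<mu> i)) * D_power (\<lambda>i. max (\<beta> i) (\<nu> i))"
proof -
  have "the_inv_into (exponents m \<times> exponents n) (std_monomial m n S D) (S_power \<gamma> * D_power \<eta>) = (\<gamma>, \<eta>)"
    if "\<gamma> \<in> exponents m" "\<eta> \<in> exponents n" for \<gamma> \<eta>
    using the_inv_into_f_f[OF inj_std_monomial, of "(\<gamma>, \<eta>)"] that by (simp add: std_monomial_def)
  then show ?thesis using assms by (simp add: lclm_monomial_def std_monomial_def)
qed

lemma max_exponents: "\<alpha> \<in> exponents k \<Longrightarrow> \<mu> \<in> exponents k \<Longrightarrow> (\<lambda>i. max (\<alpha> i) (\<mu> i)) \<in> exponents k"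
  by (auto simp: exponents_def max_def split: if_splits)

end

locale ordered_dd_finite_extension = dd_finite_extension scale R m n S D \<sigma> \<delta> +
  ordered_left_basis R "std_monomials m n S D" ord
  for scale :: "'k::field_char_0 \<Rightarrow> 'a::ring_1 \<Rightarrow> 'a" and R m n S D \<sigma> \<delta> ord
begin

text \<open>
  The strict monotonicity of the ordering forces this: if \<open>x \<noteq> 0\<close> annihilated two distinct monomials
  from the left, both products would have the same leading monomial. An annihilated monomial yields a
  second one by right multiplication with \<open>D\<^sub>1\<close>, or with \<open>S\<^sub>1\<close> if there are no \<open>D\<^sub>i\<close>; without any
  variables the only monomial is \<open>1\<close>.
\<close>

lemma monomial_right_regular:
  assumes u: "u \<in> M" and xu: "x * u = 0"
  shows "x = 0"
proof (rule ccontr)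
  assume x: "x \<noteq> 0"
  have unique: "v = u" if "v \<in> M" "x * v = 0" for v
  proof (rule ccontr)
    assume "v \<noteq> u"
    then have "v \<in> underS ord u \<or> u \<in> underS ord v"
      using ord_total[OF u that(1)] by (auto simp: underS_def)
    \<comment> \<open>The value of \<open>lead_monom\<close> at \<open>0\<close> is unspecified, but it cannot be below itself.\<close>
    then have "lead_monom 0 \<in> underS ord (lead_monom 0)"
      using ord_mult[OF _ x] xu that(2) by metis
    then show False using not_in_underS by blast
  qed
  obtain \<alpha> \<beta> where \<alpha>\<beta>: "u = S_power \<alpha> * D_power \<beta>" "\<alpha> \<in> exponents m" "\<beta> \<in> exponents n"
    using u M_iff by blast
  let ?e = "\<lambda>i. if i = 1 then 1 else 0"
  consider "n \<noteq> 0" | "n = 0" "m \<noteq> 0" | "n = 0" "m = 0" by blast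
  then show False
  proof cases
    case 1
    have e: "(\<lambda>i. \<beta> i + ?e i) \<in> exponents n" using 1 \<alpha>\<beta>(3) by (auto simp: exponents_def)
    have "u * D 1 = S_power \<alpha> * D_power (\<lambda>i. \<beta> i + ?e i)"
      unfolding \<alpha>\<beta>(1) D_power_add using power_product_single[of 1 n D] 1 by (simp add: mult.assoc)
    moreover have "x * (u * D 1) = 0" using xu by (simp flip: mult.assoc)
    moreover have "S_power \<alpha> * D_power (\<lambda>i. \<beta> i + ?e i) \<in> M" using \<alpha>\<beta>(2) e M_iff by blast
    ultimately have "S_power \<alpha> * D_power (\<lambda>i. \<beta> i + ?e i) = u" using unique by metis
    then have "(\<lambda>i. \<beta> i + ?e i) = \<beta>" using monomial_eqD(2) e \<alpha>\<beta> by blast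
    then show False by (auto dest: fun_cong[of _ _ 1])
  next
    case 2
    have e: "(\<lambda>i. \<alpha> i + ?e i) \<in> exponents m" using 2 \<alpha>\<beta>(2) by (auto simp: exponents_def)
    have "u * S 1 = S_power (\<lambda>i. \<alpha> i + ?e i) * D_power \<beta>"
      unfolding \<alpha>\<beta>(1) S_power_add using power_product_single[of 1 m S] 2 by (simp add: power_product_0)
    moreover have "x * (u * S 1) = 0" using xu by (simp flip: mult.assoc)
    moreover have "S_power (\<lambda>i. \<alpha> i + ?e i) * D_power \<beta> \<in> M" using \<alpha>\<beta>(3) e M_iff by blast
    ultimately have "S_power (\<lambda>i. \<alpha> i + ?e i) * D_power \<beta> = u" using unique by metis
    then have "(\<lambda>i. \<alpha> i + ?e i) = \<alpha>" using monomial_eqD(1) e \<alpha>\<beta> by blast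
    then show False by (auto dest: fun_cong[of _ _ 1])
  next
    case 3
    then show False using \<alpha>\<beta>(1) xu x by (simp add: power_product_0)
  qed
qed

sublocale monomial_division R M ord "lclm_monomial m n S D"
proof
  fix u x assume "u \<in> M" "x * u = 0"
  then show "x = 0" by (rule monomial_right_regular)
next
  fix u x assume "u \<in> M"
  then obtain \<alpha> \<beta> where u: "u = S_power \<alpha> * D_power \<beta>" "\<alpha> \<in> exponents m" "\<beta> \<in> exponents n"
    using M_iff by blast
  have "multiples \<alpha> \<beta> \<subseteq> {w \<in> M. right_divisible w u}"
    unfolding multiples_def u(1) using right_divisible_iff u(2,3) M_iff by blast
  then show "x * u \<in> supported {w \<in> M. right_divisible w u}"
    using mult_supported_multiples[OF u(2,3), of x] supported_mono u(1) by blast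
next
  fix u w assume "u \<in> M" "w \<in> M" "right_divisible w u"
  then show "\<exists>h. normalizes R h \<and> h * u = w"
    using M_iff right_divisible_iff ex_normalizing_monomial_quotient by metis
next
  fix u v assume "u \<in> M" "v \<in> M"
  then obtain \<alpha> \<beta> \<alpha>' \<beta>' where u: "u = S_power \<alpha> * D_power \<beta>" and v: "v = S_power \<alpha>' * D_power \<beta>'"
    and e: "\<alpha> \<in> exponents m" "\<beta> \<in> exponents n" "\<alpha>' \<in> exponents m" "\<beta>' \<in> exponents n"
    using M_iff by blast
  note max_e = max_exponents[OF e(1,3)] max_exponents[OF e(2,4)]
  note lclm_eq = lclm_monomial_eq[OF e, folded u v]
  show "lclm_monomial m n S D u v \<in> M" unfolding lclm_eq M_iff using max_e by blast
  show "right_divisible (lclm_monomial m n S D u v) u" "right_divisible (lclm_monomial m n S D u v) v"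
    unfolding lclm_eq unfolding u v right_divisible_iff[OF e(1,2) max_e] right_divisible_iff[OF e(3,4) max_e]
    by (auto simp: le_fun_def)
  fix w assume "w \<in> M" and div: "right_divisible w u" "right_divisible w v"
  then obtain \<mu> \<nu> where w: "w = S_power \<mu> * D_power \<nu>" "\<mu> \<in> exponents m" "\<nu> \<in> exponents n"
    using M_iff by blast
  show "right_divisible w (lclm_monomial m n S D u v)"
    using div unfolding lclm_eq unfolding w(1) u v right_divisible_iff[OF max_e w(2,3)]
      right_divisible_iff[OF e(1,2) w(2,3)] right_divisible_iff[OF e(3,4) w(2,3)]
    by (auto simp: le_fun_def)
qed

lemma Spoly_eq_s_poly: "Spoly R m n S D ord f g = s_poly f g"
  by (simp add: Spoly_def s_poly_def lclm_def Let_def)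

end

theorem theorem3p16:
  fixes scale :: "'k::field_char_0 \<Rightarrow> 'a::ring_1 \<Rightarrow> 'a"
    and R :: "'a set" and m n :: nat and S D :: "nat \<Rightarrow> 'a"
    and \<sigma> \<delta> :: "nat \<Rightarrow> 'a \<Rightarrow> 'a" and M :: "'a set" and ord :: "'a rel"
    and G I :: "'a set"
  assumes "dd_algebra scale R m n S D \<sigma> \<delta>"
    and "finite_field_extension scale R"
    and "M = std_monomials m n S D"
    and "dd_monomial_ordering R M ord"
    and "0 \<notin> G"
    and "I = left_ideal hull G"
  shows "left_GS_basis R M ord G I \<longleftrightarrow>
    (\<forall>g1\<in>G. \<forall>g2\<in>G. reduces_to R M ord G (Spoly R m n S D ord g1 g2) 0)"
proof -
  interpret dd_algebra scale R m n S D \<sigma> \<delta> by fact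
  interpret dd_finite_extension scale R m n S D \<sigma> \<delta> by unfold_locales fact
  interpret ordered_dd_finite_extension scale R m n S D \<sigma> \<delta> ord
    using assms(3,4) by unfold_locales simp
  show ?thesis
    unfolding Spoly_eq_s_poly assms(3,6) by (rule buchberger_criterion) fact
qed

end
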